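(* Let $n\ge2$ and let $\Omega\subset\mathbb R^n$ be an admissible domain with $\partial\Omega=\mathcal F\cup\mathcal B$ satisfying the John condition, i.e. $\Omega\subset\mathcal F\times(-\infty,0)$. Then for every $z>0$ $$R_1^\Omega(z)\ \ge\ C_{n,1}|\mathcal F|z^{n}+\frac{(n-1)\omega_{n-1}}{(2\pi)^{n-1}}\frac{|\mathcal F|}{(2h_\Omega)^n}\bigl(\Gamma(n)-\Gamma(n,2h_\Omega z)\bigr),$$ where $R_1^\Omega(z)=\sum_j(z-\nu_j)_+$ is the first Riesz mean of the sloshing eigenvalues of $\Omega$ and $h_\Omega$ is the depth of $\Omega$.
   Context: Admissible domain in $\mathbb R^n$: a bounded domain $\Omega\subset\mathbb R^n$ with Lipschitz, piecewise smooth boundary $\partial\Omega=\mathcal F\cup\mathcal B$, $\mathcal F\subset\{x_n=0\}$, $\mathcal B\subset\{x_n<0\}$, where $\mathcal F$ has positive $(n-1)$-dimensional measure $|\mathcal F|$. $\mathcal F$ is identified with a subset of $\mathbb R^{n-1}$. The depth is $h_\Omega=\sup\{|x_n|:x\in\Omega\}$. Sloshing (Steklov--Neumann) eigenvalues of $\Omega$: the numbers $0=\nu_1\le\nu_2\le\cdots\nearrow\infty$ (counted with multiplicity) for which $\Delta f=0$ in $\Omega$, $\partial f/\partial\mathbf n=0$ on $\mathcal B$, $\partial f/\partial x_n=\nu f$ on $\mathcal F$ has a nontrivial (weak) solution; equivalently, the eigenvalues given by min-max for $\int_\Omega|\nabla f|^2dx/\int_{\mathcal F}|f|^2ds$, $f\in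 H^1(\Omega)$. $(t)_+=\max\{0,t\}$. Constants: $\omega_{n-1}=\pi^{\frac{n-1}2}/\Gamma(\frac{n+1}{2})$ is the volume of the unit ball in $\mathbb R^{n-1}$; $C_{n,\gamma}=\frac{1}{(4\pi)^{\frac{n-1}{2}}}\frac{\Gamma(\gamma+1)\Gamma(n)}{\Gamma(\frac{n+1}{2})\Gamma(n+\gamma)}$; $\Gamma(n,x)=(n-1)!\,e^{-x}\sum_{k=0}^{n-1}\frac{x^k}{k!}$ is the incomplete Gamma function. *)

theory Defs
  imports "HOL-Analysis.Analysis"
begin

text \<open>
  The ambient space is \<^typ>\<open>'a \<times> real\<close> for a Euclidean space \<^typ>\<open>'a\<close> of dimension
  \<open>n - 1\<close>, so that \<open>n = DIM('a \<times> real) \<ge> 2\<close>; the last coordinate \<open>x\<^sub>n\<close> is \<^const>\<open>snd\<close>.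
  The free surface, a subset of \<open>{x\<^sub>n = 0}\<close>, is identified with a set \<open>F :: 'a set\<close>, and its
  surface measure with Lebesgue measure on \<^typ>\<open>'a\<close>.
\<close>

subsection \<open>Smooth functions\<close>

primrec C_k_on :: "nat \<Rightarrow> 'b::euclidean_space set \<Rightarrow> ('b \<Rightarrow> real) \<Rightarrow> bool" where
  "C_k_on 0 U f \<longleftrightarrow> continuous_on U f"
| "C_k_on (Suc k) U f \<longleftrightarrow>
     (\<exists>g. (\<forall>x\<in>U. GDERIV f x :> g x) \<and> (\<forall>b\<in>Basis. C_k_on k U (\<lambda>x. g x \<bullet> b)))"

text \<open>Intended for open \<open>U\<close> only.\<close>

definition smooth_on :: "'b::euclidean_space set \<Rightarrow> ('b \<Rightarrow> real) \<Rightarrow> bool" where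
  "smooth_on U f \<longleftrightarrow> (\<forall>k. C_k_on k U f)"

subsection \<open>Admissible domains\<close>

text \<open>Near each boundary point the set is, in suitable orthogonal coordinates, the subgraph of a
  Lipschitz function \<open>\<phi>\<close>. Here \<open>e\<close> is the graph direction, and \<open>\<phi>\<close> is only evaluated on the
  hyperplane orthogonal to \<open>e\<close>.\<close>

definition lipschitz_boundary :: "'b::euclidean_space set \<Rightarrow> bool" where
  "lipschitz_boundary \<Omega> \<longleftrightarrow>
     (\<forall>p\<in>frontier \<Omega>. \<exists>U e \<phi> L. open U \<and> p \<in> U \<and> norm e = 1 \<and> L-lipschitz_on UNIV \<phi> \<and>
        (\<forall>x\<in>U. x \<in> \<Omega> \<longleftrightarrow> x \<bullet> e < \<phi> (x - (x \<bullet> e) *\<^sub>R e)))"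

text \<open>Vanishing \<open>(DIM('b) - 1)\<close>-dimensional Hausdorff measure.\<close>

definition hypersurface_null :: "'b::euclidean_space set \<Rightarrow> bool" where
  "hypersurface_null N \<longleftrightarrow>
     (\<forall>\<epsilon>>0. \<exists>c r. (\<forall>i::nat. r i \<ge> (0::real)) \<and> N \<subseteq> (\<Union>i. cball (c i) (r i)) \<and>
        (\<Sum>i. ennreal (r i ^ (DIM('b) - 1))) < ennreal \<epsilon>)"

text \<open>Up to a closed set \<open>N\<close> of zero surface measure (edges, corners, conical points), the boundary
  consists of finitely many connected pieces that are smooth hypersurfaces.\<close>

definition piecewise_smooth_boundary :: "'b::euclidean_space set \<Rightarrow> bool" where
  "piecewise_smooth_boundary \<Omega> \<longleftrightarrow>
     (\<exists>N. closed N \<and> hypersurface_null N \<and> finite (components (frontier \<Omega> - N)) \<and>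
        (\<forall>p\<in>frontier \<Omega> - N. \<exists>U g v. open U \<and> p \<in> U \<and> smooth_on U g \<and> GDERIV g p :> v \<and> v \<noteq> 0 \<and>
            frontier \<Omega> \<inter> U = {x\<in>U. g x = 0}))"

definition admissible_domain ::
  "('a::euclidean_space \<times> real) set \<Rightarrow> 'a set \<Rightarrow> ('a \<times> real) set \<Rightarrow> bool" where
  "admissible_domain \<Omega> F B \<longleftrightarrow>
     open \<Omega> \<and> connected \<Omega> \<and> bounded \<Omega> \<and>
     lipschitz_boundary \<Omega> \<and> piecewise_smooth_boundary \<Omega> \<and>
     frontier \<Omega> = F \<times> {0} \<union> B \<and> B \<subseteq> {x. snd x < 0} \<and> measure lborel F > 0"

definition depth :: "('a::euclidean_space \<times> real) set \<Rightarrow> real" where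
  "depth \<Omega> = (SUP x\<in>\<Omega>. \<bar>snd x\<bar>)"

subsection \<open>The Sobolev space \<open>H\<^sup>1(\<Omega>)\<close> and traces on the free surface\<close>

definition sq_norm_on ::
  "'b::euclidean_space set \<Rightarrow> ('b \<Rightarrow> 'c::euclidean_space) \<Rightarrow> ennreal" where
  "sq_norm_on S u = (\<integral>\<^sup>+x\<in>S. ennreal ((norm (u x))\<^sup>2) \<partial>lborel)"

definition L2_on :: "'b::euclidean_space set \<Rightarrow> ('b \<Rightarrow> 'c::euclidean_space) \<Rightarrow> bool" where
  "L2_on S u \<longleftrightarrow> set_borel_measurable lborel S u \<and> sq_norm_on S u < \<infinity>"

definition weak_gradient ::
  "'b::euclidean_space set \<Rightarrow> ('b \<Rightarrow> real) \<Rightarrow> ('b \<Rightarrow> 'b) \<Rightarrow> bool" where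
  "weak_gradient \<Omega> u G \<longleftrightarrow>
     (\<forall>\<phi> d\<phi>. smooth_on UNIV \<phi> \<and> (\<forall>x. GDERIV \<phi> x :> d\<phi> x) \<and>
             (\<exists>K. compact K \<and> K \<subseteq> \<Omega> \<and> (\<forall>x. x \<notin> K \<longrightarrow> \<phi> x = 0)) \<longrightarrow>
        (LINT x:\<Omega>|lborel. u x *\<^sub>R d\<phi> x) = - (LINT x:\<Omega>|lborel. \<phi> x *\<^sub>R G x))"

text \<open>\<open>u \<in> H\<^sup>1(\<Omega>)\<close> with \<open>\<nabla>u = G\<close>.\<close>

definition H1_on :: "'b::euclidean_space set \<Rightarrow> ('b \<Rightarrow> real) \<Rightarrow> ('b \<Rightarrow> 'b) \<Rightarrow> bool" where
  "H1_on \<Omega> u G \<longleftrightarrow> L2_on \<Omega> u \<and> L2_on \<Omega> G \<and> weak_gradient \<Omega> u G"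

text \<open>The trace operator is the continuous extension to \<open>H\<^sup>1(\<Omega>)\<close> of the restriction map on
  functions smooth up to the boundary: \<open>t\<close> is the trace on \<open>F\<close> of \<open>u\<close> (with \<open>\<nabla>u = G\<close>) if smooth
  functions converging to \<open>u\<close> in \<open>H\<^sup>1(\<Omega>)\<close> have restrictions converging to \<open>t\<close> in \<open>L\<^sup>2(F)\<close>. On a bounded
  Lipschitz domain every \<open>u \<in> H\<^sup>1(\<Omega>)\<close> has a trace, unique almost everywhere.\<close>

definition has_trace_on ::
  "('a::euclidean_space \<times> real) set \<Rightarrow> 'a set \<Rightarrow> ('a \<times> real \<Rightarrow> real) \<Rightarrow>
     ('a \<times> real \<Rightarrow> 'a \<times> real) \<Rightarrow> ('a \<Rightarrow> real) \<Rightarrow> bool" where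
  "has_trace_on \<Omega> F u G t \<longleftrightarrow> L2_on F t \<and>
     (\<exists>\<phi> d\<phi>. (\<forall>k. smooth_on UNIV (\<phi> k) \<and> (\<forall>x. GDERIV (\<phi> k) x :> d\<phi> k x)) \<and>
        (\<lambda>k. sq_norm_on \<Omega> (\<lambda>x. \<phi> k x - u x)) \<longlonglongrightarrow> 0 \<and>
        (\<lambda>k. sq_norm_on \<Omega> (\<lambda>x. d\<phi> k x - G x)) \<longlonglongrightarrow> 0 \<and>
        (\<lambda>k. sq_norm_on F (\<lambda>y. \<phi> k (y, 0) - t y)) \<longlonglongrightarrow> 0)"

subsection \<open>Sloshing eigenvalues and their first Riesz mean\<close>

text \<open>A \<open>k\<close>-dimensional subspace of \<open>H\<^sup>1(\<Omega>)\<close> is given by a basis \<open>u 0, \<dots>, u (k - 1)\<close>, listed together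
  with the gradients \<open>G i\<close> and traces \<open>t i\<close>; independence is that of classes modulo
  almost everywhere equality.\<close>

definition H1_basis ::
  "('a::euclidean_space \<times> real) set \<Rightarrow> 'a set \<Rightarrow> nat \<Rightarrow> (nat \<Rightarrow> 'a \<times> real \<Rightarrow> real) \<Rightarrow>
     (nat \<Rightarrow> 'a \<times> real \<Rightarrow> 'a \<times> real) \<Rightarrow> (nat \<Rightarrow> 'a \<Rightarrow> real) \<Rightarrow> bool" where
  "H1_basis \<Omega> F k u G t \<longleftrightarrow>
     (\<forall>i<k. H1_on \<Omega> (u i) (G i) \<and> has_trace_on \<Omega> F (u i) (G i) (t i)) \<and>
     (\<forall>c::nat \<Rightarrow> real. (AE x in lborel. x \<in> \<Omega> \<longrightarrow> (\<Sum>i<k. c i * u i x) = 0) \<longrightarrow> (\<forall>i<k. c i = 0))"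

text \<open>The Rayleigh quotient of a function with gradient \<open>G\<close> and trace \<open>t\<close>. It is \<open>\<infinity>\<close> for a nonzero
  function vanishing on \<open>F\<close>; on a connected \<open>\<Omega>\<close> the case \<open>0 / 0\<close> occurs only for the zero function.\<close>

definition rayleigh ::
  "('a::euclidean_space \<times> real) set \<Rightarrow> 'a set \<Rightarrow> ('a \<times> real \<Rightarrow> 'a \<times> real) \<Rightarrow> ('a \<Rightarrow> real) \<Rightarrow> ennreal"
where
  "rayleigh \<Omega> F G t = sq_norm_on \<Omega> G / sq_norm_on F t"

text \<open>The min-max value \<open>\<nu>\<^sub>k\<close>, numbered from \<open>k = 1\<close>: the infimum over the \<open>k\<close>-dimensional subspaces
  of \<open>H\<^sup>1(\<Omega>)\<close> of the maximal Rayleigh quotient of a nonzero element.\<close>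

definition sloshing_eigenvalue ::
  "('a::euclidean_space \<times> real) set \<Rightarrow> 'a set \<Rightarrow> nat \<Rightarrow> ennreal" where
  "sloshing_eigenvalue \<Omega> F k =
     (INF (u, G, t) \<in> {(u, G, t). H1_basis \<Omega> F k u G t}.
      SUP c \<in> {c::nat \<Rightarrow> real. \<exists>i<k. c i \<noteq> 0}.
        rayleigh \<Omega> F (\<lambda>x. \<Sum>i<k. c i *\<^sub>R G i x) (\<lambda>y. \<Sum>i<k. c i * t i y))"

text \<open>Subtraction on \<^typ>\<open>ennreal\<close> truncates at \<open>0\<close>, so each term is \<open>(z - \<nu>\<^sub>j)\<^sub>+\<close>.\<close>

definition riesz_mean_1 ::
  "('a::euclidean_space \<times> real) set \<Rightarrow> 'a set \<Rightarrow> real \<Rightarrow> ennreal" where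
  "riesz_mean_1 \<Omega> F z = (\<Sum>j. ennreal z - sloshing_eigenvalue \<Omega> F (Suc j))"

subsection \<open>Constants\<close>

definition C_const :: "nat \<Rightarrow> real \<Rightarrow> real" where
  "C_const n \<gamma> = 1 / (4 * pi) powr ((real n - 1) / 2) *
     (Gamma (\<gamma> + 1) * Gamma (real n) / (Gamma ((real n + 1) / 2) * Gamma (real n + \<gamma>)))"

definition incomplete_Gamma :: "nat \<Rightarrow> real \<Rightarrow> real" where
  "incomplete_Gamma n x = fact (n - 1) * exp (- x) * (\<Sum>k<n. x ^ k / fact k)"

end

(* The trial functions are u(x) = cas(xi . x') exp(|xi| x_n), with cas = cos + sin and xi in the
   lattice (2 pi / L) Z^(n-1), |xi| < z, where F lies in a cube of side L. They are real, cas(xi . x') are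
   orthogonal on the cube, and |grad u|^2 = 2 |xi|^2 exp(2 |xi| x_n) does not depend on x'. By the John
   condition the Dirichlet energy of u is at most |F| |xi| (1 - exp(-2 |xi| h)), and the squared
   L^2(F) norm is |F| plus an odd function of xi, which cancels upon summation. Bessel's inequality
   and the averaged variational principle bound the Riesz mean below by
   |F| L^(1-n) sum_xi (z - |xi| + |xi| exp(-2 |xi| h)); letting L tend to infinity gives
   |F| (2 pi)^(1-n) times the integral of the summand over the ball of radius z. *)

theory Submission
  imports Defs "HOL-Complex_Analysis.Complex_Analysis"
begin

section \<open>Simultaneous diagonalisation of quadratic forms\<close>

text \<open>The eigenvalues are available only as min-max values: no eigenfunctions, no
  completeness, no attained infimum. A lower bound for the Riesz mean needs only upper bounds for
  them, and these come from finite-dimensional trial spaces. The averaged variational principle is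
  therefore run inside the span of finitely many trial functions, where a basis diagonalising the
  energy on \<Omega> and the boundary form on \<open>F\<close> at once takes over the role of the
  eigenfunctions. A lattice of frequencies, instead of an integral over all of them, keeps this span
  finite-dimensional; the price is the final limit. The obstacle is that the trial functions are
  orthogonal on the cube but not on \<open>F\<close>. The boundary form is thus a full Gram matrix,
  and its positivity has to come from analyticity of the trial functions. The lack of orthogonality
  costs nothing else: the averaged sums are traces, which do not depend on the basis. Since only one
  inequality has to survive the limit, Fatou's lemma suffices, and the jump of the summand at the
  cutoff radius \<open>z\<close> needs no estimate.\<close>

definition orthogonal_matrices :: "nat \<Rightarrow> (nat \<times> nat \<Rightarrow> real) set" where
  "orthogonal_matrices m = {V.
     (\<forall>p. p \<notin> {..<m} \<times> {..<m} \<longrightarrow> V p = 0) \<and>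
     (\<forall>k<m. \<forall>l<m. (\<Sum>i<m. V (k, i) * V (l, i)) = of_bool (k = l)) \<and>
     (\<forall>i<m. \<forall>j<m. (\<Sum>k<m. V (k, i) * V (k, j)) = of_bool (i = j))}"

text \<open>Matrices are functions on index pairs so that Tychonoff's theorem applies: unit rows
  confine the entries of the block to \<open>{-1..1}\<close>, and the infinitely many entries
  outside it are pinned to 0.\<close>

lemma compact_orthogonal_matrices: "compact (orthogonal_matrices m)"
proof -
  let ?K = "PiE UNIV (\<lambda>p. if p \<in> {..<m} \<times> {..<m} then {-1..1} else {0::real})"
  have "compactin (product_topology (\<lambda>_. euclidean) UNIV) ?K"
    by (subst compactin_PiE) auto
  then have K: "compact ?K"
    by (simp add: euclidean_product_topology)
  have cont: "continuous_on UNIV (\<lambda>V::nat \<times> nat \<Rightarrow> real. V p)" for p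
    by (rule continuous_on_product_coordinates)
  have "closed {V::nat \<times> nat \<Rightarrow> real. \<forall>p. p \<notin> {..<m} \<times> {..<m} \<longrightarrow> V p = 0}"
    by (intro closed_Collect_all closed_Collect_imp closed_Collect_eq cont continuous_intros) auto
  moreover have "closed {V::nat \<times> nat \<Rightarrow> real. \<forall>k<m. \<forall>l<m. (\<Sum>i<m. V (k, i) * V (l, i)) = of_bool (k = l)}"
    by (intro closed_Collect_all closed_Collect_imp closed_Collect_eq continuous_on_sum cont continuous_on_mult continuous_on_const) auto
  moreover have "closed {V::nat \<times> nat \<Rightarrow> real. \<forall>i<m. \<forall>j<m. (\<Sum>k<m. V (k, i) * V (k, j)) = of_bool (i = j)}"
    by (intro closed_Collect_all closed_Collect_imp closed_Collect_eq continuous_on_sum cont continuous_on_mult continuous_on_const) auto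
  ultimately have "closed (orthogonal_matrices m)"
    unfolding orthogonal_matrices_def by (intro closed_Collect_conj)
  moreover have "orthogonal_matrices m \<subseteq> ?K"
  proof
    fix V assume V: "V \<in> orthogonal_matrices m"
    have "\<bar>V (k, i)\<bar> \<le> 1" if "k < m" "i < m" for k i
    proof -
      have "(V (k, i))\<^sup>2 \<le> (\<Sum>i<m. V (k, i) * V (k, i))"
        unfolding power2_eq_square using that by (intro member_le_sum) auto
      also have "\<dots> = 1"
        using V that unfolding orthogonal_matrices_def by auto
      finally show ?thesis
        by (simp add: abs_square_le_1)
    qed
    then show "V \<in> ?K"
      using V unfolding orthogonal_matrices_def by (fastforce simp: abs_le_iff)
  qed
  ultimately show ?thesis
    using K by (metis compact_Int_closed inf.absorb_iff2)
qed

text \<open>Left multiplication by a plane rotation. These are the perturbations against which a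
  maximiser over all orthonormal bases is tested.\<close>

lemma rotate_rows_orthogonal:
  assumes V: "V \<in> orthogonal_matrices m" and kl: "k < m" "l < m" "k \<noteq> l" and cs: "c\<^sup>2 + s\<^sup>2 = (1::real)"
  defines "W \<equiv> (\<lambda>(p, i). if p = k then c * V (k, i) + s * V (l, i)
      else if p = l then c * V (l, i) - s * V (k, i) else V (p, i))"
  shows "W \<in> orthogonal_matrices m"
proof -
  have row: "(\<Sum>i<m. V (p, i) * V (q, i)) = of_bool (p = q)" if "p < m" "q < m" for p q
    using V that unfolding orthogonal_matrices_def by auto
  have col: "(\<Sum>p<m. V (p, i) * V (p, j)) = of_bool (i = j)" if "i < m" "j < m" for i j
    using V that unfolding orthogonal_matrices_def by auto
  have lin1: "(\<Sum>i<m. (x * V (p, i) + y * V (q, i)) * V (r, i)) = x * of_bool (p = r) + y * of_bool (q = r)"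
    if "p < m" "q < m" "r < m" for x y p q r
  proof -
    have "(\<Sum>i<m. (x * V (p, i) + y * V (q, i)) * V (r, i)) =
        x * (\<Sum>i<m. V (p, i) * V (r, i)) + y * (\<Sum>i<m. V (q, i) * V (r, i))"
      by (simp add: sum.distrib sum_distrib_left algebra_simps)
    then show ?thesis using row that by simp
  qed
  have lin2: "(\<Sum>i<m. (x * V (p, i) + y * V (q, i)) * (x' * V (p', i) + y' * V (q', i))) =
      x' * (x * of_bool (p = p') + y * of_bool (q = p')) + y' * (x * of_bool (p = q') + y * of_bool (q = q'))"
    if "p < m" "q < m" "p' < m" "q' < m" for x y p q x' y' p' q'
  proof -
    have "(\<Sum>i<m. (x * V (p, i) + y * V (q, i)) * (x' * V (p', i) + y' * V (q', i))) =
       x' * (\<Sum>i<m. (x * V (p, i) + y * V (q, i)) * V (p', i)) + y' * (\<Sum>i<m. (x * V (p, i) + y * V (q, i)) * V (q', i))"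
      by (simp add: sum.distrib sum_distrib_left algebra_simps)
    then show ?thesis using lin1 that by simp
  qed
  \<comment> \<open>\<open>x\<close>, \<open>y\<close> and the transposition \<open>\<sigma>\<close>
    give rotated and untouched rows one common formula, so that \<open>lin2\<close> covers every
    pair of rows.\<close>
  define x where "x p = (if p = k \<or> p = l then c else 1)" for p
  define y where "y p = (if p = k then s else if p = l then - s else 0)" for p
  define \<sigma> where "\<sigma> p = (if p = k then l else if p = l then k else p)" for p
  have W: "W (p, i) = x p * V (p, i) + y p * V (\<sigma> p, i)" for p i
    using kl by (auto simp: W_def x_def y_def \<sigma>_def)
  have "(\<Sum>i<m. W (p, i) * W (q, i)) = of_bool (p = q)" if "p < m" "q < m" for p q
  proof -
    have "\<sigma> p < m" "\<sigma> q < m" using that kl by (auto simp: \<sigma>_def)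
    then show ?thesis
      unfolding W using that kl cs
      by (subst lin2) (auto simp: x_def y_def \<sigma>_def power2_eq_square algebra_simps)
  qed
  moreover have "(\<Sum>p<m. W (p, i) * W (p, j)) = of_bool (i = j)" if "i < m" "j < m" for i j
  proof -
    have split: "(\<Sum>p<m. f p) = f k + (f l + (\<Sum>p\<in>{..<m} - {k} - {l}. f p))" for f :: "nat \<Rightarrow> real"
      using kl by (simp add: sum.remove[of "{..<m}" k] sum.remove[of "{..<m} - {k}" l])
    have eq: "W (k, i) * W (k, j) + W (l, i) * W (l, j) = V (k, i) * V (k, j) + V (l, i) * V (l, j)"
    proof -
      have "W (k, i) * W (k, j) + W (l, i) * W (l, j) = (c\<^sup>2 + s\<^sup>2) * (V (k, i) * V (k, j) + V (l, i) * V (l, j))"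
        using kl by (simp add: W_def power2_eq_square algebra_simps)
      then show ?thesis using cs by simp
    qed
    have "(\<Sum>p\<in>{..<m} - {k} - {l}. W (p, i) * W (p, j)) = (\<Sum>p\<in>{..<m} - {k} - {l}. V (p, i) * V (p, j))"
      by (intro sum.cong) (auto simp: W_def)
    then have "(\<Sum>p<m. W (p, i) * W (p, j)) = (\<Sum>p<m. V (p, i) * V (p, j))"
      using eq by (simp add: split)
    then show ?thesis using col that by simp
  qed
  moreover have "\<forall>p. p \<notin> {..<m} \<times> {..<m} \<longrightarrow> W p = 0"
    using V kl unfolding orthogonal_matrices_def W_def by (auto split: prod.splits)
  ultimately show ?thesis
    unfolding orthogonal_matrices_def by auto
qed

text \<open>The weights \<open>k\<close> in the functional \<open>\<Sum>k. k \<cdot> a(v\<^sub>k, v\<^sub>k)\<close> are distinct, so a maximiser over all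
  orthonormal bases has no first-order change under rotations of two of its vectors: the
  off-diagonal entries vanish, and the diagonal ones are sorted.\<close>

lemma symmetric_diagonalization:
  fixes a :: "nat \<Rightarrow> nat \<Rightarrow> real"
  assumes sym: "\<And>i j. a i j = a j i"
  obtains V \<mu> where
    "\<And>k l. k < m \<Longrightarrow> l < m \<Longrightarrow> (\<Sum>i<m. V k i * V l i) = of_bool (k = l)"
    "\<And>i j. i < m \<Longrightarrow> j < m \<Longrightarrow> (\<Sum>k<m. V k i * V k j) = of_bool (i = j)"
    "\<And>k l. k < m \<Longrightarrow> l < m \<Longrightarrow> (\<Sum>i<m. \<Sum>j<m. V k i * V l j * a i j) = \<mu> k * of_bool (k = l)"
    "\<And>k l. k \<le> l \<Longrightarrow> l < m \<Longrightarrow> \<mu> k \<le> \<mu> l"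
proof -
  define q where "q (V::nat \<times> nat \<Rightarrow> real) k l = (\<Sum>i<m. \<Sum>j<m. V (k, i) * V (l, j) * a i j)" for V and k l :: nat
  define f where "f V = (\<Sum>k<m. real k * q V k k)" for V
  have "orthogonal_matrices m \<noteq> {}"
  proof -
    have "(\<Sum>i<m. of_bool (k = i \<and> k < m) * of_bool (l = i \<and> l < m)) = (of_bool (k = l)::real)" if "k < m" for k l
    proof -
      have "(\<Sum>i<m. of_bool (k = i \<and> k < m) * of_bool (l = i \<and> l < m)) = (\<Sum>i<m. if i = k then of_bool (k = l) else (0::real))"
        using that by (intro sum.cong) auto
      then show ?thesis using that by simp
    qed
    note 1 = this
    have "(\<Sum>k<m. of_bool (k = i \<and> k < m) * of_bool (k = j \<and> k < m)) = (of_bool (i = j)::real)" if "i < m" for i j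
    proof -
      have "(\<Sum>k<m. of_bool (k = i \<and> k < m) * of_bool (k = j \<and> k < m)) = (\<Sum>k<m. if k = i then of_bool (i = j) else (0::real))"
        using that by (intro sum.cong) auto
      then show ?thesis using that by simp
    qed
    then have "(\<lambda>(i, j). of_bool (i = j \<and> i < m)) \<in> orthogonal_matrices m"
      unfolding orthogonal_matrices_def using 1 by auto
    then show ?thesis by blast
  qed
  moreover have "continuous_on (orthogonal_matrices m) f"
    unfolding f_def q_def
    by (intro continuous_on_sum continuous_on_mult continuous_on_const
        continuous_on_subset[OF continuous_on_product_coordinates]) auto
  ultimately obtain V where V: "V \<in> orthogonal_matrices m"
    and max: "\<And>W. W \<in> orthogonal_matrices m \<Longrightarrow> f W \<le> f V"
    using continuous_attains_sup[OF compact_orthogonal_matrices] by metis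
  have qsym: "q V k l = q V l k" for k l
    unfolding q_def by (subst sum.swap) (simp add: sym mult_ac)
  have main: "q V k l = 0 \<and> (real k - real l) * (q V l l - q V k k) \<le> 0" if kl: "k < m" "l < m" "k \<noteq> l" for k l
  proof -
    define D where "D = real k - real l"
    \<comment> \<open>The left-hand side equals \<open>f W - f V\<close> for the rotation
      \<open>W\<close> of rows \<open>k\<close> and \<open>l\<close>; the weights of the two rows
      survive only through their difference \<open>D\<close>.\<close>
    have ineq: "s\<^sup>2 * (D * (q V l l - q V k k)) + 2 * c * s * (D * q V k l) \<le> 0" if cs: "c\<^sup>2 + s\<^sup>2 = 1" for c s
    proof -
      define W where "W \<equiv> (\<lambda>(p, i). if p = k then c * V (k, i) + s * V (l, i)
        else if p = l then c * V (l, i) - s * V (k, i) else V (p, i))"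
      have W: "W \<in> orthogonal_matrices m"
        unfolding W_def by (rule rotate_rows_orthogonal[OF V kl cs])
      have split: "(\<Sum>p<m. g p) = g k + (g l + (\<Sum>p\<in>{..<m} - {k} - {l}. g p))" for g :: "nat \<Rightarrow> real"
        using kl by (simp add: sum.remove[of "{..<m}" k] sum.remove[of "{..<m} - {k}" l])
      have "q W k k = (\<Sum>i<m. \<Sum>j<m. (c * V (k, i) + s * V (l, i)) * (c * V (k, j) + s * V (l, j)) * a i j)"
        by (simp add: q_def W_def)
      also have "\<dots> = c * c * q V k k + c * s * q V k l + s * c * q V l k + s * s * q V l l"
        unfolding q_def by (simp add: sum.distrib sum_distrib_left algebra_simps)
      finally have 1: "q W k k = c\<^sup>2 * q V k k + 2 * c * s * q V k l + s\<^sup>2 * q V l l"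
        using qsym[of k l] by (simp add: power2_eq_square)
      have "q W l l = (\<Sum>i<m. \<Sum>j<m. (c * V (l, i) - s * V (k, i)) * (c * V (l, j) - s * V (k, j)) * a i j)"
        using kl by (simp add: q_def W_def)
      also have "\<dots> = c * c * q V l l - c * s * q V l k - s * c * q V k l + s * s * q V k k"
        unfolding q_def by (simp add: sum.distrib sum_subtractf sum_distrib_left algebra_simps)
      finally have 2: "q W l l = c\<^sup>2 * q V l l - 2 * c * s * q V k l + s\<^sup>2 * q V k k"
        using qsym[of k l] by (simp add: power2_eq_square)
      have 3: "(\<Sum>p\<in>{..<m} - {k} - {l}. real p * q W p p) = (\<Sum>p\<in>{..<m} - {k} - {l}. real p * q V p p)"
        by (intro sum.cong) (auto simp: q_def W_def)
      have "f W \<le> f V" by (rule max[OF W])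
      then have "real k * q W k k + real l * q W l l \<le> real k * q V k k + real l * q V l l"
        unfolding f_def split using 3 by simp
      moreover have "c\<^sup>2 = 1 - s\<^sup>2" using cs by simp
      ultimately show ?thesis
        unfolding 1 2 D_def by (simp add: algebra_simps)
    qed
    define x where "x = D * (q V l l - q V k k)"
    define y where "y = D * q V k l"
    have x: "x \<le> 0" using ineq[of 0 1] by (simp add: x_def)
    \<comment> \<open>Here \<open>t\<close> is the tangent of the rotation angle. A quadratic in
      \<open>t\<close> without constant term that is nowhere positive has no linear term; below it
      is tested at \<open>t = y\<close> if \<open>x = 0\<close> and at the vertex
      \<open>t = - y / x\<close> otherwise.\<close>
    have t: "t\<^sup>2 * x + 2 * t * y \<le> 0" for t
    proof -
      define r where "r = sqrt (1 + t\<^sup>2)"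
      have r: "r > 0" "r\<^sup>2 = 1 + t\<^sup>2" unfolding r_def by (auto simp: add_pos_nonneg)
      have "(1 / r)\<^sup>2 + (t / r)\<^sup>2 = 1"
      proof -
        have "1 + t\<^sup>2 \<noteq> 0" using r by (metis less_irrefl power_eq_0_iff)
        then show ?thesis using r(2) by (simp add: power_divide flip: add_divide_distrib)
      qed
      from ineq[OF this] have "(t\<^sup>2 * x + 2 * t * y) / r\<^sup>2 \<le> 0"
        unfolding x_def y_def by (simp add: power2_eq_square add_divide_distrib)
      moreover have "r\<^sup>2 > 0" using r(1) by simp
      ultimately show ?thesis by (metis divide_le_0_iff not_less)
    qed
    have "y = 0"
    proof (cases "x = 0")
      case True
      then show ?thesis using t[of y] by (simp flip: power2_eq_square)
    next
      case False
      then have x': "x < 0" using x by simp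
      have "(- y / x)\<^sup>2 * x + 2 * (- y / x) * y = - (y\<^sup>2 / x)"
        using False by (simp add: power2_eq_square field_simps)
      then have "y\<^sup>2 / x \<ge> 0" using t[of "- y / x"] by simp
      then show ?thesis using x' by (simp add: zero_le_divide_iff)
    qed
    moreover have "D \<noteq> 0" using kl by (simp add: D_def)
    ultimately show ?thesis using x by (simp add: x_def y_def D_def)
  qed
  show ?thesis
  proof (rule that[of "curry V" "\<lambda>k. q V k k"])
    show "q V k k \<le> q V l l" if "k \<le> l" "l < m" for k l
      using main[of k l] that by (cases "k = l") (auto simp: mult_le_0_iff)
    show "(\<Sum>i<m. \<Sum>j<m. curry V k i * curry V l j * a i j) = q V k k * of_bool (k = l)" if "k < m" "l < m" for k l
      using main[of k l] that by (cases "k = l") (auto simp: q_def)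
  qed (use V in \<open>auto simp: orthogonal_matrices_def\<close>)
qed

text \<open>Diagonalise \<open>b\<close>, divide its eigenvectors by the roots of the eigenvalues to
  get a \<open>b\<close>-orthonormal basis \<open>W\<close>, then rotate \<open>W\<close> by the
  orthogonal \<open>U\<close> that diagonalises \<open>a\<close> in this basis; the rotation keeps
  \<open>b\<close>-orthonormality. The last conclusion is completeness: the transpose of
  \<open>C\<close> times \<open>C\<close> inverts the matrix of \<open>b\<close>.\<close>

lemma simultaneous_diagonalization:
  fixes a b :: "nat \<Rightarrow> nat \<Rightarrow> real"
  assumes sym: "\<And>i j. a i j = a j i" "\<And>i j. b i j = b j i"
    and pos: "\<And>c. (\<exists>i<m. c i \<noteq> 0) \<Longrightarrow> (\<Sum>i<m. \<Sum>j<m. c i * c j * b i j) > 0"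
  obtains C \<mu> where
    "\<And>k l. k < m \<Longrightarrow> l < m \<Longrightarrow> (\<Sum>i<m. \<Sum>j<m. C k i * C l j * b i j) = of_bool (k = l)"
    "\<And>k l. k < m \<Longrightarrow> l < m \<Longrightarrow> (\<Sum>i<m. \<Sum>j<m. C k i * C l j * a i j) = \<mu> k * of_bool (k = l)"
    "\<And>k l. k \<le> l \<Longrightarrow> l < m \<Longrightarrow> \<mu> k \<le> \<mu> l"
    "\<And>i j. i < m \<Longrightarrow> j < m \<Longrightarrow> (\<Sum>k<m. C k i * (\<Sum>p<m. C k p * b p j)) = of_bool (i = j)"
proof -
  obtain V \<beta> where V:
    "\<And>k l. k < m \<Longrightarrow> l < m \<Longrightarrow> (\<Sum>i<m. V k i * V l i) = of_bool (k = l)"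
    "\<And>i j. i < m \<Longrightarrow> j < m \<Longrightarrow> (\<Sum>k<m. V k i * V k j) = of_bool (i = j)"
    "\<And>k l. k < m \<Longrightarrow> l < m \<Longrightarrow> (\<Sum>i<m. \<Sum>j<m. V k i * V l j * b i j) = \<beta> k * of_bool (k = l)"
    "\<And>k l. k \<le> l \<Longrightarrow> l < m \<Longrightarrow> \<beta> k \<le> \<beta> l"
    by (rule symmetric_diagonalization[of b m, OF sym(2)], rule that)
  have \<beta>: "\<beta> k > 0" if "k < m" for k
  proof -
    have "\<exists>i<m. V k i \<noteq> 0"
    proof (rule ccontr)
      assume "\<not> ?thesis"
      then have "(\<Sum>i<m. V k i * V k i) = 0" by (intro sum.neutral) auto
      then show False using V(1) that by simp
    qed
    from pos[OF this] show ?thesis using V(3)[of k k] that by simp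
  qed
  define W where "W k i = V k i / sqrt (\<beta> k)" for k i
  define a' where "a' k l = (\<Sum>i<m. \<Sum>j<m. W k i * W l j * a i j)" for k l
  have Wb: "(\<Sum>i<m. \<Sum>j<m. W k i * W l j * b i j) = of_bool (k = l)" if "k < m" "l < m" for k l
  proof -
    have "(\<Sum>i<m. \<Sum>j<m. W k i * W l j * b i j) = (\<Sum>i<m. \<Sum>j<m. V k i * V l j * b i j) / (sqrt (\<beta> k) * sqrt (\<beta> l))"
      by (simp add: W_def sum_divide_distrib)
    then show ?thesis using V(3)[OF that] \<beta>[OF that(1)] by (cases "k = l") auto
  qed
  \<comment> \<open>From a diagonal form to an eigenvector equation: the column relation of
    \<open>V\<close> is inserted as a resolution of the identity.\<close>
  have Vb: "(\<Sum>p<m. V k p * b p j) = \<beta> k * V k j" if "k < m" "j < m" for k j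
  proof -
    have "(\<Sum>p<m. V k p * b p j) = (\<Sum>q<m. (\<Sum>p<m. V k p * b p q) * of_bool (q = j))"
      using that by (simp add: of_bool_def if_distrib cong: if_cong)
    also have "\<dots> = (\<Sum>q<m. (\<Sum>p<m. V k p * b p q) * (\<Sum>l<m. V l q * V l j))"
      using V(2) that by (intro sum.cong) auto
    also have "\<dots> = (\<Sum>q<m. \<Sum>p<m. \<Sum>l<m. V k p * V l q * b p q * V l j)"
      unfolding sum_product by (simp add: mult_ac)
    also have "\<dots> = (\<Sum>p<m. \<Sum>q<m. \<Sum>l<m. V k p * V l q * b p q * V l j)"
      by (rule sum.swap)
    also have "\<dots> = (\<Sum>p<m. \<Sum>l<m. \<Sum>q<m. V k p * V l q * b p q * V l j)"
      by (intro sum.cong refl sum.swap)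
    also have "\<dots> = (\<Sum>l<m. \<Sum>p<m. \<Sum>q<m. V k p * V l q * b p q * V l j)"
      by (rule sum.swap)
    also have "\<dots> = (\<Sum>l<m. (\<Sum>p<m. \<Sum>q<m. V k p * V l q * b p q) * V l j)"
      by (simp add: sum_distrib_right)
    also have "\<dots> = (\<Sum>l<m. if l = k then \<beta> k * V k j else 0)"
      using V(3) that by (intro sum.cong) auto
    finally show ?thesis using that by simp
  qed
  have a'sym: "a' i j = a' j i" for i j
    unfolding a'_def by (subst sum.swap, intro sum.cong refl) (use sym(1) in \<open>simp add: mult_ac\<close>)
  obtain U \<mu> where U:
    "\<And>k l. k < m \<Longrightarrow> l < m \<Longrightarrow> (\<Sum>i<m. U k i * U l i) = of_bool (k = l)"
    "\<And>i j. i < m \<Longrightarrow> j < m \<Longrightarrow> (\<Sum>k<m. U k i * U k j) = of_bool (i = j)"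
    "\<And>k l. k < m \<Longrightarrow> l < m \<Longrightarrow> (\<Sum>i<m. \<Sum>j<m. U k i * U l j * a' i j) = \<mu> k * of_bool (k = l)"
    "\<And>k l. k \<le> l \<Longrightarrow> l < m \<Longrightarrow> \<mu> k \<le> \<mu> l"
    by (rule symmetric_diagonalization[of a' m, OF a'sym], rule that)
  define C where "C k i = (\<Sum>p<m. U k p * W p i)" for k i
  have pull: "(\<Sum>i<m. \<Sum>j<m. C k i * C l j * e i j) = (\<Sum>p<m. \<Sum>q<m. U k p * U l q * (\<Sum>i<m. \<Sum>j<m. W p i * W q j * e i j))" for e k l
  proof -
    have "(\<Sum>i<m. \<Sum>j<m. C k i * C l j * e i j) = (\<Sum>i<m. \<Sum>j<m. \<Sum>p<m. \<Sum>q<m. U k p * U l q * (W p i * W q j * e i j))"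
    proof (intro sum.cong refl)
      fix i j
      show "C k i * C l j * e i j = (\<Sum>p<m. \<Sum>q<m. U k p * U l q * (W p i * W q j * e i j))"
        unfolding C_def sum_product unfolding sum_distrib_right by (simp add: mult_ac)
    qed
    also have "\<dots> = (\<Sum>i<m. \<Sum>p<m. \<Sum>j<m. \<Sum>q<m. U k p * U l q * (W p i * W q j * e i j))"
      by (intro sum.cong refl sum.swap)
    also have "\<dots> = (\<Sum>p<m. \<Sum>i<m. \<Sum>j<m. \<Sum>q<m. U k p * U l q * (W p i * W q j * e i j))"
      by (rule sum.swap)
    also have "\<dots> = (\<Sum>p<m. \<Sum>i<m. \<Sum>q<m. \<Sum>j<m. U k p * U l q * (W p i * W q j * e i j))"
      by (intro sum.cong refl sum.swap)
    also have "\<dots> = (\<Sum>p<m. \<Sum>q<m. \<Sum>i<m. \<Sum>j<m. U k p * U l q * (W p i * W q j * e i j))"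
      by (intro sum.cong refl sum.swap)
    finally show ?thesis by (simp add: sum_distrib_left)
  qed
  show ?thesis
  proof (rule that[of C \<mu>])
    fix k l assume kl: "k < m" "l < m"
    have "(\<Sum>i<m. \<Sum>j<m. C k i * C l j * b i j) = (\<Sum>p<m. \<Sum>q<m. if q = p then U k p * U l p else 0)"
      unfolding pull using Wb by (intro sum.cong) auto
    then show "(\<Sum>i<m. \<Sum>j<m. C k i * C l j * b i j) = of_bool (k = l)"
      using U(1) kl by simp
    show "(\<Sum>i<m. \<Sum>j<m. C k i * C l j * a i j) = \<mu> k * of_bool (k = l)"
      unfolding pull using U(3) kl by (simp add: a'_def)
  next
    fix i j assume ij: "i < m" "j < m"
    have Wb': "(\<Sum>p<m. W q p * b p j) = sqrt (\<beta> q) * V q j" if "q < m" for q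
    proof -
      have "(\<Sum>p<m. W q p * b p j) = (\<Sum>p<m. V q p * b p j) / sqrt (\<beta> q)"
        by (simp add: W_def sum_divide_distrib)
      also have "\<dots> = \<beta> q / sqrt (\<beta> q) * V q j" using Vb that ij by simp
      finally show ?thesis using \<beta>[OF that] by (simp add: real_div_sqrt)
    qed
    have Cb: "(\<Sum>p<m. C k p * b p j) = (\<Sum>q<m. U k q * (\<Sum>p<m. W q p * b p j))" for k
      unfolding C_def sum_distrib_right sum_distrib_left by (subst sum.swap) (simp add: mult_ac)
    have "(\<Sum>k<m. C k i * (\<Sum>p<m. C k p * b p j)) = (\<Sum>k<m. (\<Sum>r<m. U k r * W r i) * (\<Sum>q<m. U k q * (\<Sum>p<m. W q p * b p j)))"
      unfolding Cb by (simp add: C_def)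
    also have "\<dots> = (\<Sum>k<m. (\<Sum>r<m. U k r * W r i) * (\<Sum>q<m. U k q * (sqrt (\<beta> q) * V q j)))"
      using Wb' by simp
    also have "\<dots> = (\<Sum>k<m. \<Sum>r<m. \<Sum>q<m. (U k r * U k q) * (W r i * (sqrt (\<beta> q) * V q j)))"
      by (simp add: sum_product mult_ac)
    also have "\<dots> = (\<Sum>r<m. \<Sum>k<m. \<Sum>q<m. (U k r * U k q) * (W r i * (sqrt (\<beta> q) * V q j)))"
      by (rule sum.swap)
    also have "\<dots> = (\<Sum>r<m. \<Sum>q<m. \<Sum>k<m. (U k r * U k q) * (W r i * (sqrt (\<beta> q) * V q j)))"
      by (intro sum.cong refl sum.swap)
    also have "\<dots> = (\<Sum>r<m. \<Sum>q<m. (\<Sum>k<m. U k r * U k q) * (W r i * (sqrt (\<beta> q) * V q j)))"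
      by (simp add: sum_distrib_right)
    also have "\<dots> = (\<Sum>r<m. \<Sum>q<m. if q = r then W r i * (sqrt (\<beta> r) * V r j) else 0)"
      using U(2) by (intro sum.cong) auto
    also have "\<dots> = (\<Sum>r<m. V r i * V r j)"
      using \<beta> by (intro sum.cong) (auto simp: W_def less_imp_neq[symmetric])
    finally show "(\<Sum>k<m. C k i * (\<Sum>p<m. C k p * b p j)) = of_bool (i = j)"
      using V(2) ij by simp
  qed (fact U(4))
qed

section \<open>Smooth functions as elements of \<open>H\<^sup>1(\<Omega>)\<close>\<close>

lemma GDERIV_iff: "GDERIV f x :> g \<longleftrightarrow> (f has_derivative (\<lambda>h. h \<bullet> g)) (at x)"
  by (simp add: gderiv_def inner_commute)

text \<open>This family is closed under partial derivatives: the horizontal ones replace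
  \<open>(p, q)\<close> by a multiple of \<open>(q, - p)\<close>, the vertical one by
  \<open>(r * p, r * q)\<close>. The gradient is written in exactly this shape so that smoothness
  follows by induction with \<open>p\<close> and \<open>q\<close> arbitrary.\<close>

lemma GDERIV_exp_trig:
  fixes \<xi> :: "'a::euclidean_space"
  shows "GDERIV (\<lambda>x::'a \<times> real. exp (r * snd x) * (p * cos (\<xi> \<bullet> fst x) + q * sin (\<xi> \<bullet> fst x))) x :>
    (exp (r * snd x) * (q * cos (\<xi> \<bullet> fst x) + (- p) * sin (\<xi> \<bullet> fst x))) *\<^sub>R (\<xi>, 0) +
    (exp (r * snd x) * ((r * p) * cos (\<xi> \<bullet> fst x) + (r * q) * sin (\<xi> \<bullet> fst x))) *\<^sub>R (0, 1)"
  unfolding GDERIV_iff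
  by (auto intro!: derivative_eq_intros simp: inner_prod_def inner_commute algebra_simps)

section \<open>Closure properties of smooth functions\<close>

lemma C_k_on_add:
  "C_k_on k U f \<Longrightarrow> C_k_on k U g \<Longrightarrow> C_k_on k U (\<lambda>x. f x + g x)"
proof (induction k arbitrary: f g)
  case 0
  then show ?case by (simp add: continuous_on_add)
next
  case (Suc k)
  then obtain F G where "\<forall>x\<in>U. GDERIV f x :> F x" "\<forall>b\<in>Basis. C_k_on k U (\<lambda>x. F x \<bullet> b)"
    "\<forall>x\<in>U. GDERIV g x :> G x" "\<forall>b\<in>Basis. C_k_on k U (\<lambda>x. G x \<bullet> b)" by auto
  then show ?case
    using Suc.IH by (auto intro!: exI[of _ "\<lambda>x. F x + G x"] GDERIV_add simp: inner_add_left)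
qed

lemma C_k_on_cmult: "C_k_on k U f \<Longrightarrow> C_k_on k U (\<lambda>x. c * f x)"
proof (induction k arbitrary: f)
  case 0
  then show ?case by (simp add: continuous_on_mult_left)
next
  case (Suc k)
  then obtain F where F: "\<forall>x\<in>U. GDERIV f x :> F x" "\<forall>b\<in>Basis. C_k_on k U (\<lambda>x. F x \<bullet> b)"
    by auto
  have "\<forall>x\<in>U. GDERIV (\<lambda>x. c * f x) x :> c *\<^sub>R F x"
    using F(1) GDERIV_mult[OF GDERIV_const] by fastforce
  then show ?case
    using Suc.IH F(2) by (auto intro!: exI[of _ "\<lambda>x. c *\<^sub>R F x"])
qed

lemma C_k_on_multc: "C_k_on k U f \<Longrightarrow> C_k_on k U (\<lambda>x. f x * c)"
  using C_k_on_cmult[of k U f c] by (simp add: mult.commute)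

lemma C_k_on_const: "C_k_on k U (\<lambda>x. c)"
proof (induction k arbitrary: c)
  case (Suc k)
  then show ?case by (auto intro!: exI[of _ "\<lambda>x. 0"] GDERIV_const)
qed auto

lemma smooth_on_sum:
  assumes "\<And>i. i \<in> I \<Longrightarrow> smooth_on U (f i)"
  shows "smooth_on U (\<lambda>x. \<Sum>i\<in>I. c i * f i x)"
  using assms
proof (induction I rule: infinite_finite_induct)
  case (insert i I)
  then show ?case unfolding smooth_on_def by (auto intro!: C_k_on_add C_k_on_cmult)
qed (auto simp: smooth_on_def C_k_on_const)

lemma smooth_exp_trig:
  fixes \<xi> :: "'a::euclidean_space"
  shows "smooth_on U (\<lambda>x::'a \<times> real. exp (r * snd x) * (p * cos (\<xi> \<bullet> fst x) + q * sin (\<xi> \<bullet> fst x)))"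
proof -
  have "C_k_on k U (\<lambda>x::'a \<times> real. exp (r * snd x) * (p * cos (\<xi> \<bullet> fst x) + q * sin (\<xi> \<bullet> fst x)))" for k
  proof (induction k arbitrary: p q)
    case 0
    show ?case by (auto intro!: continuous_intros)
  next
    case (Suc k)
    show ?case
      unfolding C_k_on.simps
      by (rule exI, intro conjI ballI, rule GDERIV_exp_trig, unfold inner_add_left inner_scaleR_left)
        (rule C_k_on_add; rule C_k_on_multc; rule Suc)
  qed
  then show ?thesis by (simp add: smooth_on_def)
qed

lemma GDERIV_unique: "GDERIV f x :> g \<Longrightarrow> GDERIV f x :> h \<Longrightarrow> g = h"
  unfolding GDERIV_iff
  by (metis (mono_tags) has_derivative_unique inner_commute vector_eq_rdot)

lemma smooth_on_gradient_continuous: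
  assumes "smooth_on UNIV f" "\<And>x. GDERIV f x :> g x"
  shows "continuous_on UNIV g"
proof -
  obtain G where G: "\<And>x. GDERIV f x :> G x" "\<And>b. b \<in> Basis \<Longrightarrow> continuous_on UNIV (\<lambda>x. G x \<bullet> b)"
    using assms(1) unfolding smooth_on_def
    by (metis C_k_on.simps UNIV_I)
  then have "g = G" using assms(2) GDERIV_unique by blast
  have "continuous_on UNIV (\<lambda>x. \<Sum>b\<in>Basis. (G x \<bullet> b) *\<^sub>R b)"
    using G(2) by (intro continuous_on_sum continuous_on_scaleR continuous_on_const)
  then show ?thesis unfolding euclidean_representation \<open>g = G\<close> .
qed

section \<open>Integration by parts against compactly supported functions\<close>

lemma integrable_continuous_compact_support:
  fixes f :: "'b::euclidean_space \<Rightarrow> 'c::euclidean_space"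
  assumes "continuous_on UNIV f" "compact K" "\<And>x. x \<notin> K \<Longrightarrow> f x = 0"
  shows "integrable lborel f"
proof -
  have "integrable lborel (\<lambda>x. indicator K x *\<^sub>R f x)"
    by (rule borel_integrable_compact[OF assms(2) continuous_on_subset[OF assms(1)]]) auto
  moreover have "(\<lambda>x. indicator K x *\<^sub>R f x) = f" using assms(3) by (auto simp: indicator_def)
  ultimately show ?thesis by simp
qed

text \<open>By translation invariance all difference quotients have integral zero.\<close>

lemma integral_gradient_compact_support:
  fixes f :: "'b::euclidean_space \<Rightarrow> real"
  assumes f: "\<And>x. GDERIV f x :> g x" and g: "continuous_on UNIV g"
    and K: "compact K" "\<And>x. x \<notin> K \<Longrightarrow> f x = 0"
  shows "(LINT x|lborel. g x) = 0"
proof -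
  have cf: "continuous_on UNIV f"
    using f by (meson GDERIV_iff continuous_at_imp_continuous_on has_derivative_continuous)
  have g0: "g x = 0" if "x \<notin> K" for x
  proof -
    have "GDERIV f x :> 0"
      unfolding GDERIV_iff
      by (rule has_derivative_transform_within_open[of "\<lambda>x. 0" _ _ _ "- K"])
        (use that K compact_imp_closed in auto)
    then show ?thesis using f GDERIV_unique by blast
  qed
  have gint: "integrable lborel g" and fint: "integrable lborel f"
    using integrable_continuous_compact_support K g g0 cf by blast+
  obtain M where M: "\<And>x. norm (g x) \<le> M"
  proof -
    have "bounded (g ` K)" using compact_continuous_image[OF continuous_on_subset[OF g] K(1)] compact_imp_bounded by auto
    then obtain M where "\<And>x. x \<in> K \<Longrightarrow> norm (g x) \<le> M" unfolding bounded_iff by auto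
    then have "norm (g x) \<le> max M 0" for x using g0[of x] by (cases "x \<in> K") (auto simp: le_max_iff_disj)
    then show ?thesis using that by blast
  qed
  obtain R where R: "\<And>x. x \<in> K \<Longrightarrow> norm x \<le> R"
    using K(1) compact_imp_bounded bounded_iff by metis
  have "(LINT x|lborel. g x \<bullet> b) = 0" if b: "b \<in> Basis" for b
  proof -
    define t where "t i = 1 / real (Suc i)" for i
    have t: "t i > 0" "t i \<le> 1" for i by (auto simp: t_def)
    have t0: "t \<longlonglongrightarrow> 0" unfolding t_def using LIMSEQ_inverse_real_of_nat by (simp add: inverse_eq_divide)
    define q where "q i x = (f (x + t i *\<^sub>R b) - f x) / t i" for i x
    have fmeas: "f \<in> borel_measurable borel" using cf borel_measurable_continuous_onI by blast
    have q0: "(LINT x|lborel. q i x) = 0" for i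
    proof -
      have comm: "(\<lambda>x. f (t i *\<^sub>R b + x)) = (\<lambda>x. f (x + t i *\<^sub>R b))"
        by (intro ext arg_cong[where f = f] add.commute)
      have meas: "(+) (t i *\<^sub>R b) \<in> lborel \<rightarrow>\<^sub>M borel" by measurable
      have eq: "(LINT x|lborel. f (x + t i *\<^sub>R b)) = (LINT x|lborel. f x)"
        by (rule integral_distr[OF meas fmeas, unfolded lborel_distr_plus comm, symmetric])
      have int: "integrable lborel (\<lambda>x. f (x + t i *\<^sub>R b))"
        by (rule iffD1[OF integrable_distr_eq[OF meas fmeas, unfolded lborel_distr_plus comm] fint])
      have "(LINT x|lborel. q i x) = (LINT x|lborel. f (x + t i *\<^sub>R b) - f x) / t i"
        unfolding q_def by (rule integral_divide_zero)
      also have "\<dots> = ((LINT x|lborel. f (x + t i *\<^sub>R b)) - (LINT x|lborel. f x)) / t i"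
        by (intro arg_cong2[where f = "(/)"] Bochner_Integration.integral_diff int fint refl)
      also have "\<dots> = 0"
        by (subst eq, subst diff_self, rule div_0)
      finally show ?thesis .
    qed
    have "(\<lambda>i. LINT x|lborel. q i x) \<longlonglongrightarrow> (LINT x|lborel. g x \<bullet> b)"
    \<comment> \<open>The mean value inequality bounds each quotient by \<open>M\<close>; since the
      shifts have length at most 1, all quotients vanish outside the ball of radius
      \<open>R + 1\<close>.\<close>
    proof (rule integral_dominated_convergence[where w = "\<lambda>x. indicator (cball 0 (R + 1)) x *\<^sub>R M"])
      show "(\<lambda>x. g x \<bullet> b) \<in> borel_measurable lborel" using gint by auto
      show "q i \<in> borel_measurable lborel" for i unfolding q_def using fint by measurable
      show "integrable lborel (\<lambda>x. indicator (cball 0 (R + 1)) x *\<^sub>R M)"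
        by (rule borel_integrable_compact) auto
      show "AE x in lborel. (\<lambda>i. q i x) \<longlonglongrightarrow> g x \<bullet> b"
      proof (rule AE_I2)
        fix x
        have "((\<lambda>s. f (x + s *\<^sub>R b)) has_derivative (\<lambda>h. (h *\<^sub>R b) \<bullet> g (x + 0 *\<^sub>R b))) (at 0)"
          by (rule has_derivative_compose[where f = "\<lambda>s. x + s *\<^sub>R b" and g = f])
            (use f GDERIV_iff in \<open>auto intro!: derivative_eq_intros\<close>)
        then have "((\<lambda>s. f (x + s *\<^sub>R b)) has_real_derivative (g x \<bullet> b)) (at 0)"
          unfolding has_field_derivative_def by (rule has_derivative_eq_rhs) (auto simp: inner_commute)
        then have "((\<lambda>s. (f (x + s *\<^sub>R b) - f x) / s) \<longlongrightarrow> g x \<bullet> b) (at 0)"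
          by (simp add: has_field_derivative_iff)
        moreover have "filterlim t (at 0) sequentially"
          using t0 t(1) by (auto simp: filterlim_at less_imp_neq[symmetric] intro!: always_eventually)
        ultimately show "(\<lambda>i. q i x) \<longlonglongrightarrow> g x \<bullet> b"
          unfolding q_def by (rule filterlim_compose)
      qed
      show "AE x in lborel. norm (q i x) \<le> indicator (cball 0 (R + 1)) x *\<^sub>R M" for i
      proof (rule AE_I2)
        fix x
        have "\<bar>f (x + t i *\<^sub>R b) - f x\<bar> \<le> M * norm (t i *\<^sub>R b)"
        proof -
          have "norm (f (x + t i *\<^sub>R b) - f x) \<le> M * norm ((x + t i *\<^sub>R b) - x)"
          proof (rule differentiable_bound[where S = UNIV and f' = "\<lambda>x h. h \<bullet> g x"])
            show "onorm (\<lambda>h. h \<bullet> g y) \<le> M" for y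
              by (rule onorm_le) (metis Cauchy_Schwarz_ineq2 M mult.commute mult_right_mono norm_ge_zero order_trans real_norm_def)
          qed (use f GDERIV_iff has_derivative_at_withinI in auto)
          then show ?thesis by simp
        qed
        then have 1: "norm (q i x) \<le> M" using t[of i] b by (simp add: q_def field_simps)
        show "norm (q i x) \<le> indicator (cball 0 (R + 1)) x *\<^sub>R M"
        proof (cases "x \<in> cball 0 (R + 1)")
          case False
          then have "norm x > R + 1" by simp
          moreover have "norm x \<le> norm (x + t i *\<^sub>R b) + norm (t i *\<^sub>R b)"
            by (metis add_diff_cancel_right' norm_triangle_ineq4)
          moreover have "norm (t i *\<^sub>R b) \<le> 1" using t[of i] b by simp
          ultimately have "x + t i *\<^sub>R b \<notin> K" "x \<notin> K" using R by force+
          then show ?thesis using K(2) False by (simp add: q_def)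
        qed (use 1 in auto)
      qed
    qed
    then show ?thesis unfolding q0 by (simp add: LIMSEQ_const_iff)
  qed
  note inner0 = this
  show ?thesis
  proof (rule euclidean_eqI)
    fix b :: 'b assume "b \<in> Basis"
    then show "(LINT x|lborel. g x) \<bullet> b = 0 \<bullet> b"
      unfolding integral_inner_left[OF gint, symmetric] inner_zero_left by (rule inner0)
  qed
qed

section \<open>Continuous functions in L2 of a bounded set, and their inner products\<close>

lemma set_integrable_continuous_bounded:
  fixes f :: "'b::euclidean_space \<Rightarrow> 'c::euclidean_space"
  assumes f: "continuous_on UNIV f" and S: "bounded S" "S \<in> sets borel"
  shows "set_integrable lborel S f"
proof -
  have "compact (closure S)" using S(1) by simp
  then have "set_integrable lborel (closure S) f"
    unfolding set_integrable_def by (rule borel_integrable_compact) (use f continuous_on_subset in blast)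
  then show ?thesis
    by (rule set_integrable_subset) (use S closure_subset in auto)
qed

lemma L2_on_continuous:
  fixes f :: "'b::euclidean_space \<Rightarrow> 'c::euclidean_space"
  assumes f: "continuous_on UNIV f" and S: "bounded S" "S \<in> sets borel"
  shows "L2_on S f"
proof -
  have "set_integrable lborel S (\<lambda>x. (norm (f x))\<^sup>2)"
    by (intro set_integrable_continuous_bounded continuous_intros f S)
  then have "(\<integral>\<^sup>+x. ennreal (norm (indicator S x *\<^sub>R (norm (f x))\<^sup>2)) \<partial>lborel) < \<infinity>"
    unfolding set_integrable_def integrable_iff_bounded by auto
  moreover have "ennreal (norm (indicator S x *\<^sub>R (norm (f x))\<^sup>2)) = ennreal ((norm (f x))\<^sup>2) * indicator S x" for x
    by (auto simp: indicator_def)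
  moreover have "set_borel_measurable lborel S f"
    using set_integrable_continuous_bounded[OF assms] unfolding set_integrable_def set_borel_measurable_def by auto
  ultimately show ?thesis unfolding L2_on_def sq_norm_on_def by simp
qed

text \<open>One Gram expansion for both forms: vector-valued \<open>f\<close> serves the Dirichlet
  energy, real-valued \<open>f\<close> the boundary norm, where scaling and inner product are
  multiplication.\<close>

lemma set_integral_inner_sum:
  fixes f :: "nat \<Rightarrow> 'b::euclidean_space \<Rightarrow> 'c::euclidean_space"
  assumes f: "\<And>i. i < m \<Longrightarrow> continuous_on UNIV (f i)" and S: "bounded S" "S \<in> sets borel"
  shows "(LINT x:S|lborel. (\<Sum>i<m. c i *\<^sub>R f i x) \<bullet> (\<Sum>j<m. d j *\<^sub>R f j x)) =
    (\<Sum>i<m. \<Sum>j<m. c i * d j * (LINT x:S|lborel. f i x \<bullet> f j x))"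
proof -
  have int: "set_integrable lborel S (\<lambda>x. f i x \<bullet> f j x)" if "i < m" "j < m" for i j
    by (intro set_integrable_continuous_bounded continuous_intros f S that)
  have eq: "(\<Sum>i<m. c i *\<^sub>R f i x) \<bullet> (\<Sum>j<m. d j *\<^sub>R f j x) = (\<Sum>i<m. \<Sum>j<m. c i * d j * (f i x \<bullet> f j x))" for x
  proof -
    have "(\<Sum>i<m. c i *\<^sub>R f i x) \<bullet> (\<Sum>j<m. d j *\<^sub>R f j x) = (\<Sum>i<m. \<Sum>j<m. (c i *\<^sub>R f i x) \<bullet> (d j *\<^sub>R f j x))"
      unfolding inner_sum_left inner_sum_right by (rule sum.swap)
    then show ?thesis by (simp add: mult_ac)
  qed
  have "(LINT x:S|lborel. (\<Sum>i<m. c i *\<^sub>R f i x) \<bullet> (\<Sum>j<m. d j *\<^sub>R f j x)) =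
     (LINT x|lborel. (\<Sum>i<m. \<Sum>j<m. c i * d j * (indicator S x *\<^sub>R (f i x \<bullet> f j x))))"
    unfolding set_lebesgue_integral_def eq by (simp add: sum_distrib_left mult_ac)
  also have "\<dots> = (\<Sum>i<m. (LINT x|lborel. (\<Sum>j<m. c i * d j * (indicator S x *\<^sub>R (f i x \<bullet> f j x)))))"
    using int by (intro Bochner_Integration.integral_sum Bochner_Integration.integrable_sum integrable_mult_right) (auto simp: set_integrable_def)
  also have "\<dots> = (\<Sum>i<m. \<Sum>j<m. (LINT x|lborel. c i * d j * (indicator S x *\<^sub>R (f i x \<bullet> f j x))))"
    using int by (intro sum.cong refl Bochner_Integration.integral_sum integrable_mult_right) (auto simp: set_integrable_def)
  finally show ?thesis unfolding set_lebesgue_integral_def by simp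
qed

lemma sq_norm_on_continuous:
  fixes f :: "'b::euclidean_space \<Rightarrow> 'c::euclidean_space"
  assumes f: "continuous_on UNIV f" and S: "bounded S" "S \<in> sets borel"
  shows "sq_norm_on S f = ennreal (LINT x:S|lborel. f x \<bullet> f x)"
proof -
  have int: "set_integrable lborel S (\<lambda>x. f x \<bullet> f x)"
    by (intro set_integrable_continuous_bounded continuous_intros S f)
  have "sq_norm_on S f = (\<integral>\<^sup>+x. ennreal (indicator S x *\<^sub>R (f x \<bullet> f x)) \<partial>lborel)"
    unfolding sq_norm_on_def by (intro nn_integral_cong) (auto simp: indicator_def power2_norm_eq_inner)
  also have "\<dots> = ennreal (LINT x:S|lborel. f x \<bullet> f x)"
    unfolding set_lebesgue_integral_def
    by (rule nn_integral_eq_integral[OF int[unfolded set_integrable_def]]) simp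
  finally show ?thesis .
qed

text \<open>The two integrands add up to the gradient of \<open>v * \<phi>\<close>, which has
  compact support, so their sum has integral zero over the whole space. Both vanish outside
  \<open>K\<close>, hence the integrals over \<Omega> are the full ones.\<close>

lemma weak_gradient_smooth:
  fixes v :: "'b::euclidean_space \<Rightarrow> real"
  assumes v: "smooth_on UNIV v" "\<And>x. GDERIV v x :> g x"
  shows "weak_gradient \<Omega> v g"
  unfolding weak_gradient_def
proof (intro allI impI, elim conjE exE)
  fix \<phi> d\<phi> and K :: "'b set"
  assume \<phi>: "smooth_on UNIV \<phi>" "\<forall>x. GDERIV \<phi> x :> d\<phi> x" and K: "compact K" "K \<subseteq> \<Omega>" "\<forall>x. x \<notin> K \<longrightarrow> \<phi> x = 0"
  have d\<phi>0: "d\<phi> x = 0" if "x \<notin> K" for x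
  proof -
    have "GDERIV \<phi> x :> 0"
      unfolding GDERIV_iff
      by (rule has_derivative_transform_within_open[of "\<lambda>x. 0" _ _ _ "- K"])
        (use that K compact_imp_closed in auto)
    then show ?thesis using \<phi>(2) GDERIV_unique by blast
  qed
  have c: "continuous_on UNIV v" "continuous_on UNIV \<phi>"
    using v(1) \<phi>(1) unfolding smooth_on_def by (metis C_k_on.simps(1))+
  have cg: "continuous_on UNIV g" "continuous_on UNIV d\<phi>"
    using smooth_on_gradient_continuous v \<phi> by blast+
  have int: "integrable lborel (\<lambda>x. v x *\<^sub>R d\<phi> x)" "integrable lborel (\<lambda>x. \<phi> x *\<^sub>R g x)"
    by (rule integrable_continuous_compact_support[OF _ K(1)]; use c cg d\<phi>0 K in \<open>auto intro!: continuous_intros\<close>)+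
  have "(LINT x|lborel. v x *\<^sub>R d\<phi> x + \<phi> x *\<^sub>R g x) = 0"
  proof (rule integral_gradient_compact_support[OF _ _ K(1)])
    show "GDERIV (\<lambda>x. v x * \<phi> x) x :> v x *\<^sub>R d\<phi> x + \<phi> x *\<^sub>R g x" for x
      using v(2) \<phi>(2) by (intro GDERIV_mult) auto
  qed (use c cg K in \<open>auto intro!: continuous_intros\<close>)
  then have "(LINT x|lborel. v x *\<^sub>R d\<phi> x) + (LINT x|lborel. \<phi> x *\<^sub>R g x) = 0"
    by (subst Bochner_Integration.integral_add[OF int, symmetric])
  then have sum0: "(LINT x|lborel. v x *\<^sub>R d\<phi> x) = - (LINT x|lborel. \<phi> x *\<^sub>R g x)"
    by (rule eq_neg_iff_add_eq_0[THEN iffD2])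
  have 1: "(\<lambda>x. indicator \<Omega> x *\<^sub>R (v x *\<^sub>R d\<phi> x)) = (\<lambda>x. v x *\<^sub>R d\<phi> x)"
    using d\<phi>0 K(2) by (fastforce simp: indicator_def)
  have 2: "(\<lambda>x. indicator \<Omega> x *\<^sub>R (\<phi> x *\<^sub>R g x)) = (\<lambda>x. \<phi> x *\<^sub>R g x)"
    using K(2,3) by (fastforce simp: indicator_def)
  show "(LINT x:\<Omega>|lborel. v x *\<^sub>R d\<phi> x) = - (LINT x:\<Omega>|lborel. \<phi> x *\<^sub>R g x)"
    unfolding set_lebesgue_integral_def 1 2 by (rule sum0)
qed

text \<open>For a function smooth on the whole space the constant sequence is an admissible
  approximation in \<open>has_trace_on\<close>, so its trace is the plain restriction.\<close>

lemma smooth_H1_trace: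
  fixes v :: "'a::euclidean_space \<times> real \<Rightarrow> real"
  assumes \<Omega>: "open \<Omega>" "bounded \<Omega>" and F: "bounded F" "F \<in> sets borel"
    and v: "smooth_on UNIV v" "\<And>x. GDERIV v x :> g x"
  shows "H1_on \<Omega> v g" "has_trace_on \<Omega> F v g (\<lambda>y. v (y, 0))"
proof -
  have cv: "continuous_on UNIV v" using v(1) unfolding smooth_on_def by (metis C_k_on.simps(1))
  have cg: "continuous_on UNIV g" using smooth_on_gradient_continuous v by blast
  show "H1_on \<Omega> v g"
    unfolding H1_on_def using \<Omega> cv cg v by (intro conjI L2_on_continuous weak_gradient_smooth) auto
  have "continuous_on UNIV (\<lambda>y. v (y, 0))"
    by (rule continuous_on_compose2[OF cv]) (auto intro!: continuous_intros)
  then have "L2_on F (\<lambda>y. v (y, 0))" by (intro L2_on_continuous F)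
  moreover have "sq_norm_on S (\<lambda>x. w x - w x) = 0" for S and w :: "'d::euclidean_space \<Rightarrow> 'e::euclidean_space"
    by (simp add: sq_norm_on_def)
  ultimately show "has_trace_on \<Omega> F v g (\<lambda>y. v (y, 0))"
    unfolding has_trace_on_def using v
    by (intro conjI exI[of _ "\<lambda>k. v"] exI[of _ "\<lambda>k. g"]) (auto simp: sq_norm_on_def)
qed

section \<open>The averaged variational principle\<close>

lemma GDERIV_sum:
  assumes "\<And>i. i \<in> I \<Longrightarrow> GDERIV (f i) x :> g i"
  shows "GDERIV (\<lambda>x. \<Sum>i\<in>I. c i * f i x) x :> (\<Sum>i\<in>I. c i *\<^sub>R g i)"
proof -
  have "((\<lambda>x. \<Sum>i\<in>I. c i * f i x) has_derivative (\<lambda>h. \<Sum>i\<in>I. c i * (h \<bullet> g i))) (at x)"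
    using assms unfolding GDERIV_iff by (intro has_derivative_sum has_derivative_mult_right) auto
  then show ?thesis
    unfolding GDERIV_iff by (simp add: inner_sum_right)
qed

text \<open>In a basis \<open>w\<^sub>k\<close> diagonalising both forms, with Rayleigh
  quotients \<open>\<mu>\<^sub>k \<ge> \<nu>\<^sub>k\<^sub>+\<^sub>1\<close>, the hypothesis \<open>bessel\<close> says that the weights
  \<open>\<gamma>\<^sub>k = (\<Sum>j. \<langle>w\<^sub>k, v\<^sub>j\<rangle>\<^sup>2) / K\<close> are at most \<open>1\<close>, so that \<open>(z - \<mu>\<^sub>k)\<^sub>+ \<ge> \<gamma>\<^sub>k (z - \<mu>\<^sub>k)\<close>; summing
  over \<open>k\<close> gives traces, which can be computed in the original basis.\<close>

lemma riesz_mean_ge_trial: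
  fixes v :: "nat \<Rightarrow> 'a::euclidean_space \<times> real \<Rightarrow> real"
    and g :: "nat \<Rightarrow> 'a \<times> real \<Rightarrow> 'a \<times> real"
  assumes \<Omega>: "open \<Omega>" "bounded \<Omega>" and F: "bounded F" "F \<in> sets borel"
    and v: "\<And>i. i < m \<Longrightarrow> smooth_on UNIV (v i)" "\<And>i x. i < m \<Longrightarrow> GDERIV (v i) x :> g i x"
    and indep: "\<And>c. AE x in lborel. x \<in> \<Omega> \<longrightarrow> (\<Sum>i<m. c i * v i x) = 0 \<Longrightarrow> \<forall>i<m. c i = 0"
    and A: "\<And>i j. A i j = (LINT x:\<Omega>|lborel. g i x \<bullet> g j x)"
    and B: "\<And>i j. B i j = (LINT y:F|lborel. v i (y, 0) * v j (y, 0))"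
    and pos: "\<And>c. \<exists>i<m. c i \<noteq> 0 \<Longrightarrow> (\<Sum>i<m. \<Sum>j<m. c i * c j * B i j) > 0"
    and bessel: "\<And>c. (\<Sum>j<m. (\<Sum>i<m. c i * B i j)\<^sup>2) \<le> K * (\<Sum>i<m. \<Sum>j<m. c i * c j * B i j)"
    and K: "K > 0"
  shows "ennreal ((\<Sum>j<m. z * B j j - A j j) / K) \<le> riesz_mean_1 \<Omega> F z"
proof -
  have \<Omega>': "\<Omega> \<in> sets borel" using \<Omega>(1) by simp
  have cg: "continuous_on UNIV (g i)" if "i < m" for i
    using smooth_on_gradient_continuous v that by blast
  have ct: "continuous_on UNIV (\<lambda>y. v i (y, 0))" if "i < m" for i
  proof -
    have "continuous_on UNIV (v i)" using v(1)[OF that] unfolding smooth_on_def by (metis C_k_on.simps(1))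
    then show ?thesis by (rule continuous_on_compose2) (auto intro!: continuous_intros)
  qed
  have sym: "A i j = A j i" "B i j = B j i" for i j
    by (simp_all add: A B inner_commute mult.commute)
  obtain C \<mu> where C:
    "\<And>k l. k < m \<Longrightarrow> l < m \<Longrightarrow> (\<Sum>i<m. \<Sum>j<m. C k i * C l j * B i j) = of_bool (k = l)"
    "\<And>k l. k < m \<Longrightarrow> l < m \<Longrightarrow> (\<Sum>i<m. \<Sum>j<m. C k i * C l j * A i j) = \<mu> k * of_bool (k = l)"
    "\<And>k l. k \<le> l \<Longrightarrow> l < m \<Longrightarrow> \<mu> k \<le> \<mu> l"
    "\<And>i j. i < m \<Longrightarrow> j < m \<Longrightarrow> (\<Sum>k<m. C k i * (\<Sum>p<m. C k p * B p j)) = of_bool (i = j)"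
    by (rule simultaneous_diagonalization[of A B m, OF sym pos], assumption, rule that)
  define w where "w k x = (\<Sum>p<m. C k p * v p x)" for k x
  define G where "G k x = (\<Sum>p<m. C k p *\<^sub>R g p x)" for k x
  have sw: "smooth_on UNIV (w k)" for k
    unfolding w_def using v(1) by (intro smooth_on_sum) auto
  have gw: "GDERIV (w k) x :> G k x" for k x
    unfolding w_def G_def using v(2) by (intro GDERIV_sum) auto
  have cG: "continuous_on UNIV (G k)" for k
    unfolding G_def using cg by (intro continuous_intros) auto
  have cw: "continuous_on UNIV (\<lambda>y. w k (y, 0))" for k
    unfolding w_def using ct by (intro continuous_intros) auto
  have AG: "(LINT x:\<Omega>|lborel. G k x \<bullet> G l x) = \<mu> k * of_bool (k = l)" if "k < m" "l < m" for k l
    unfolding G_def using set_integral_inner_sum[of m g \<Omega> "C k" "C l", OF cg \<Omega>(2) \<Omega>'] C(2)[OF that]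
    by (simp add: A)
  have BW: "(LINT y:F|lborel. w k (y, 0) \<bullet> w l (y, 0)) = of_bool (k = l)" if "k < m" "l < m" for k l
    unfolding w_def using set_integral_inner_sum[of m "\<lambda>i y. v i (y, 0)" F "C k" "C l", OF ct F] C(1)[OF that]
    by (simp add: B)
  have \<mu>0: "\<mu> k \<ge> 0" if "k < m" for k
  proof -
    have "(LINT x:\<Omega>|lborel. G k x \<bullet> G k x) \<ge> 0"
      unfolding set_lebesgue_integral_def by (intro Bochner_Integration.integral_nonneg) auto
    then show ?thesis using AG that by simp
  qed
  \<comment> \<open>Index shift: the diagonal vectors are numbered from 0 and the eigenvalues from
    1, so \<open>w 0\<close>, ..., \<open>w k\<close> span a trial space for eigenvalue number
    \<open>Suc k\<close>.\<close>
  have basis: "H1_basis \<Omega> F (Suc k) w G (\<lambda>i y. w i (y, 0))" if k: "k < m" for k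
    unfolding H1_basis_def
  proof (intro conjI allI impI)
    fix i
    show "H1_on \<Omega> (w i) (G i)" "has_trace_on \<Omega> F (w i) (G i) (\<lambda>y. w i (y, 0))"
      by (rule smooth_H1_trace[OF \<Omega> F sw gw])+
  next
    fix c :: "nat \<Rightarrow> real" and l
    assume AE: "AE x in lborel. x \<in> \<Omega> \<longrightarrow> (\<Sum>i<Suc k. c i * w i x) = 0" and l: "l < Suc k"
    have "(\<Sum>i<Suc k. c i * w i x) = (\<Sum>p<m. (\<Sum>i<Suc k. c i * C i p) * v p x)" for x
      unfolding w_def sum_distrib_left sum_distrib_right by (subst sum.swap) (simp only: mult_ac)
    with AE have "AE x in lborel. x \<in> \<Omega> \<longrightarrow> (\<Sum>p<m. (\<Sum>i<Suc k. c i * C i p) * v p x) = 0"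
      by simp
    from indep[OF this] have 0: "(\<Sum>i<Suc k. c i * C i p) = 0" if "p < m" for p using that by blast
    \<comment> \<open>The boundary inner product with \<open>w l\<close> extracts the coefficient
      \<open>c l\<close>.\<close>
    have "c l = (\<Sum>i<Suc k. if i = l then c i else 0)"
      using l by (simp del: sum.lessThan_Suc)
    also have "\<dots> = (\<Sum>i<Suc k. c i * (\<Sum>p<m. \<Sum>q<m. C i p * C l q * B p q))"
      using C(1) l k by (intro sum.cong) auto
    also have "\<dots> = (\<Sum>i<Suc k. \<Sum>p<m. (c i * C i p) * (\<Sum>q<m. C l q * B p q))"
      by (simp only: sum_distrib_left mult_ac)
    also have "\<dots> = (\<Sum>p<m. (\<Sum>i<Suc k. c i * C i p) * (\<Sum>q<m. C l q * B p q))"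
      unfolding sum_distrib_right by (rule sum.swap)
    also have "\<dots> = 0"
      by (intro sum.neutral ballI) (simp only: 0 lessThan_iff mult_zero_left)
    finally show "c l = 0" .
  qed
  have \<nu>: "sloshing_eigenvalue \<Omega> F (Suc k) \<le> ennreal (\<mu> k)" if k: "k < m" for k
    unfolding sloshing_eigenvalue_def
  proof (rule INF_lower2)
    show "(w, G, \<lambda>i y. w i (y, 0)) \<in> {(u, G, t). H1_basis \<Omega> F (Suc k) u G t}" using basis[OF k] by simp
    have "rayleigh \<Omega> F (\<lambda>x. \<Sum>i<Suc k. c i *\<^sub>R G i x) (\<lambda>y. \<Sum>i<Suc k. c i * w i (y, 0)) \<le> ennreal (\<mu> k)"
      if c: "\<exists>i<Suc k. c i \<noteq> 0" for c
    proof -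
      have "sq_norm_on \<Omega> (\<lambda>x. \<Sum>i<Suc k. c i *\<^sub>R G i x) =
          ennreal (\<Sum>i<Suc k. \<Sum>j<Suc k. c i * c j * (LINT x:\<Omega>|lborel. G i x \<bullet> G j x))"
        by (subst sq_norm_on_continuous, intro continuous_on_sum continuous_on_scaleR continuous_on_const cG \<Omega>(2) \<Omega>', fact \<Omega>(2), fact \<Omega>',
            rule arg_cong[where f = ennreal], rule set_integral_inner_sum[OF cG \<Omega>(2) \<Omega>'])
      also have "(\<Sum>i<Suc k. \<Sum>j<Suc k. c i * c j * (LINT x:\<Omega>|lborel. G i x \<bullet> G j x)) =
          (\<Sum>i<Suc k. \<Sum>j<Suc k. if j = i then \<mu> i * (c i)\<^sup>2 else 0)"
        using AG k by (intro sum.cong) (auto simp: power2_eq_square)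
      also have "\<dots> = (\<Sum>i<Suc k. \<mu> i * (c i)\<^sup>2)"
        by (simp del: sum.lessThan_Suc)
      finally have 1: "sq_norm_on \<Omega> (\<lambda>x. \<Sum>i<Suc k. c i *\<^sub>R G i x) = ennreal (\<Sum>i<Suc k. \<mu> i * (c i)\<^sup>2)" .
      have "sq_norm_on F (\<lambda>y. \<Sum>i<Suc k. c i *\<^sub>R w i (y, 0)) =
          ennreal (\<Sum>i<Suc k. \<Sum>j<Suc k. c i * c j * (LINT y:F|lborel. w i (y, 0) \<bullet> w j (y, 0)))"
        by (subst sq_norm_on_continuous, intro continuous_on_sum continuous_on_scaleR continuous_on_const cw F, fact F(1), fact F(2),
            rule arg_cong[where f = ennreal], rule set_integral_inner_sum[OF cw F])
      also have "(\<Sum>i<Suc k. \<Sum>j<Suc k. c i * c j * (LINT y:F|lborel. w i (y, 0) \<bullet> w j (y, 0))) =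
          (\<Sum>i<Suc k. \<Sum>j<Suc k. if j = i then (c i)\<^sup>2 else 0)"
        using BW k by (intro sum.cong) (auto simp: power2_eq_square)
      also have "\<dots> = (\<Sum>i<Suc k. (c i)\<^sup>2)"
        by (simp del: sum.lessThan_Suc)
      finally have 2: "sq_norm_on F (\<lambda>y. \<Sum>i<Suc k. c i * w i (y, 0)) = ennreal (\<Sum>i<Suc k. (c i)\<^sup>2)"
        by (simp only: real_scaleR_def)
      have pos: "(\<Sum>i<Suc k. (c i)\<^sup>2) > 0"
      proof -
        obtain i where "i < Suc k" "c i \<noteq> 0" using c by blast
        then show ?thesis by (intro sum_pos2[of _ i]) auto
      qed
      \<comment> \<open>The \<open>\<mu>\<close> are sorted, so the largest Rayleigh quotient on the
        span of \<open>w 0\<close>, ..., \<open>w k\<close> is \<open>\<mu> k\<close>.\<close>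
      have "(\<Sum>i<Suc k. \<mu> i * (c i)\<^sup>2) \<le> (\<Sum>i<Suc k. \<mu> k * (c i)\<^sup>2)"
        using C(3) k by (intro sum_mono mult_right_mono) auto
      also have "\<dots> = \<mu> k * (\<Sum>i<Suc k. (c i)\<^sup>2)" by (rule sum_distrib_left[symmetric])
      finally have "ennreal (\<Sum>i<Suc k. \<mu> i * (c i)\<^sup>2) \<le> ennreal (\<Sum>i<Suc k. (c i)\<^sup>2) * ennreal (\<mu> k)"
        using \<mu>0[OF k] pos by (subst ennreal_mult[symmetric]) (auto simp: mult.commute intro!: ennreal_leI simp del: sum.lessThan_Suc)
      then show ?thesis
        unfolding rayleigh_def 1 2 using pos
        by (intro divide_le_posI_ennreal) (auto simp del: sum.lessThan_Suc)
    qed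
    then show "(case (w, G, \<lambda>i y. w i (y, 0)) of (u, G, t) \<Rightarrow> SUP c \<in> {c::nat \<Rightarrow> real. \<exists>i<Suc k. c i \<noteq> 0}.
        rayleigh \<Omega> F (\<lambda>x. \<Sum>i<Suc k. c i *\<^sub>R G i x) (\<lambda>y. \<Sum>i<Suc k. c i * t i y)) \<le> ennreal (\<mu> k)"
      unfolding prod.case by (intro SUP_least) (simp only: mem_Collect_eq)
  qed
  \<comment> \<open>\<open>D k j\<close> is the boundary inner product of \<open>w k\<close> with
    \<open>v j\<close>.\<close>
  define D where "D k j = (\<Sum>p<m. C k p * B p j)" for k j
  define \<gamma> where "\<gamma> k = (\<Sum>j<m. (D k j)\<^sup>2) / K" for k
  have \<gamma>: "0 \<le> \<gamma> k" "\<gamma> k \<le> 1" if "k < m" for k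
    using bessel[of "C k"] C(1)[OF that that] K by (auto simp: \<gamma>_def D_def intro!: sum_nonneg divide_nonneg_pos)
  \<comment> \<open>By completeness of \<open>C\<close>, \<open>v j\<close> is the sum of
    \<open>D k j\<close> times \<open>w k\<close>. The identity expands \<open>e j j\<close>, the
    value at \<open>v j\<close> of an arbitrary form \<open>e\<close>, in the basis
    \<open>w\<close>; it is used for both \<open>A\<close> and \<open>B\<close>.\<close>
  have expand: "(\<Sum>k<m. \<Sum>l<m. D k j * D l j * (\<Sum>p<m. \<Sum>q<m. C k p * C l q * e p q)) = e j j" if j: "j < m" for e :: "nat \<Rightarrow> nat \<Rightarrow> real" and j
  proof -
    have "e j j = (\<Sum>p<m. \<Sum>q<m. of_bool (p = j) * of_bool (q = j) * e p q)"
    proof -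
      have "(\<Sum>p<m. \<Sum>q<m. of_bool (p = j) * of_bool (q = j) * e p q) = (\<Sum>p<m. if p = j then (\<Sum>q<m. if q = j then e p q else 0) else 0)"
        by (intro sum.cong) auto
      then show ?thesis using j by simp
    qed
    also have "\<dots> = (\<Sum>p<m. \<Sum>q<m. (\<Sum>k<m. C k p * D k j) * (\<Sum>l<m. C l q * D l j) * e p q)"
      unfolding D_def using C(4) j by (intro sum.cong) auto
    also have "\<dots> = (\<Sum>p<m. \<Sum>q<m. \<Sum>k<m. \<Sum>l<m. D k j * D l j * (C k p * C l q * e p q))"
    proof (intro sum.cong refl)
      fix p q
      show "(\<Sum>k<m. C k p * D k j) * (\<Sum>l<m. C l q * D l j) * e p q = (\<Sum>k<m. \<Sum>l<m. D k j * D l j * (C k p * C l q * e p q))"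
        unfolding sum_product unfolding sum_distrib_right by (simp add: mult_ac)
    qed
    also have "\<dots> = (\<Sum>p<m. \<Sum>k<m. \<Sum>q<m. \<Sum>l<m. D k j * D l j * (C k p * C l q * e p q))"
      by (intro sum.cong refl sum.swap)
    also have "\<dots> = (\<Sum>k<m. \<Sum>p<m. \<Sum>q<m. \<Sum>l<m. D k j * D l j * (C k p * C l q * e p q))"
      by (rule sum.swap)
    also have "\<dots> = (\<Sum>k<m. \<Sum>p<m. \<Sum>l<m. \<Sum>q<m. D k j * D l j * (C k p * C l q * e p q))"
      by (intro sum.cong refl sum.swap)
    also have "\<dots> = (\<Sum>k<m. \<Sum>l<m. \<Sum>p<m. \<Sum>q<m. D k j * D l j * (C k p * C l q * e p q))"
      by (intro sum.cong refl sum.swap)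
    finally show ?thesis by (simp add: sum_distrib_left)
  qed
  have Bjj: "(\<Sum>k<m. (D k j)\<^sup>2) = B j j" if "j < m" for j
  proof -
    have "B j j = (\<Sum>k<m. \<Sum>l<m. D k j * D l j * of_bool (k = l))"
      unfolding expand[OF that, of B, symmetric] using C(1) by (intro sum.cong) auto
    also have "\<dots> = (\<Sum>k<m. \<Sum>l<m. if l = k then (D k j)\<^sup>2 else 0)"
      by (intro sum.cong) (auto simp: power2_eq_square)
    finally show ?thesis by simp
  qed
  have Ajj: "(\<Sum>k<m. \<mu> k * (D k j)\<^sup>2) = A j j" if "j < m" for j
  proof -
    have "A j j = (\<Sum>k<m. \<Sum>l<m. D k j * D l j * (\<mu> k * of_bool (k = l)))"
      unfolding expand[OF that, of A, symmetric] using C(2) by (intro sum.cong) auto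
    also have "\<dots> = (\<Sum>k<m. \<Sum>l<m. if l = k then \<mu> k * (D k j)\<^sup>2 else 0)"
      by (intro sum.cong) (auto simp: power2_eq_square)
    finally show ?thesis by simp
  qed
  \<comment> \<open>Both forms are diagonal in \<open>w\<close>, so the trace over the trial
    functions becomes a weighted sum over \<open>k\<close>.\<close>
  have "(\<Sum>j<m. z * B j j - A j j) = (\<Sum>j<m. \<Sum>k<m. (z - \<mu> k) * (D k j)\<^sup>2)"
    by (intro sum.cong refl) (simp add: Bjj[symmetric] Ajj[symmetric] left_diff_distrib sum_subtractf sum_distrib_left)
  also have "\<dots> = (\<Sum>k<m. \<Sum>j<m. (z - \<mu> k) * (D k j)\<^sup>2)"
    by (rule sum.swap)
  finally have "(\<Sum>j<m. z * B j j - A j j) / K = (\<Sum>k<m. \<gamma> k * (z - \<mu> k))"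
    by (simp add: \<gamma>_def sum_divide_distrib sum_distrib_left sum_distrib_right mult_ac)
  also have "\<dots> \<le> (\<Sum>k<m. max 0 (z - \<mu> k))"
  proof (intro sum_mono)
    fix k assume "k \<in> {..<m}"
    then have "0 \<le> \<gamma> k" "\<gamma> k \<le> 1" using \<gamma> by auto
    then show "\<gamma> k * (z - \<mu> k) \<le> max 0 (z - \<mu> k)"
      by (cases "z - \<mu> k \<ge> 0") (auto simp: max_def mult_left_le_one_le mult_le_0_iff)
  qed
  finally have "ennreal ((\<Sum>j<m. z * B j j - A j j) / K) \<le> ennreal (\<Sum>k<m. max 0 (z - \<mu> k))"
    by (rule ennreal_leI)
  also have "\<dots> = (\<Sum>k<m. ennreal (max 0 (z - \<mu> k)))" by simp
  also have "\<dots> \<le> (\<Sum>k<m. ennreal z - sloshing_eigenvalue \<Omega> F (Suc k))"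
  proof (intro sum_mono)
    fix k assume "k \<in> {..<m}"
    then have k: "k < m" by simp
    have "ennreal (max 0 (z - \<mu> k)) = ennreal z - ennreal (\<mu> k)"
      using \<mu>0[OF k] by (simp add: ennreal_minus max_def ennreal_neg)
    also have "\<dots> \<le> ennreal z - sloshing_eigenvalue \<Omega> F (Suc k)"
      using \<nu>[OF k] by (intro ennreal_minus_mono) auto
    finally show "ennreal (max 0 (z - \<mu> k)) \<le> ennreal z - sloshing_eigenvalue \<Omega> F (Suc k)" .
  qed
  also have "\<dots> \<le> riesz_mean_1 \<Omega> F z"
    unfolding riesz_mean_1_def by (intro sum_le_suminf) auto
  finally show ?thesis .
qed

section \<open>Hartley functions on a lattice\<close>

definition cas :: "real \<Rightarrow> real" where
  "cas t = cos t + sin t"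

text \<open>For \<open>s = t\<close> this is 1 plus an odd function, which gives the boundary norms.
  Over the cube the sine term always integrates to zero and the cosine term does so unless the
  frequencies agree, which gives orthogonality.\<close>

lemma cas_mult: "cas s * cas t = cos (s - t) + sin (s + t)"
  by (simp add: cas_def cos_diff sin_add algebra_simps)

lemma continuous_on_cas [continuous_intros]:
  fixes f :: "'b::t2_space \<Rightarrow> real"
  shows "continuous_on S f \<Longrightarrow> continuous_on S (\<lambda>x. cas (f x))"
  unfolding cas_def by (intro continuous_on_add continuous_on_cos continuous_on_sin)

definition scaled_lattice :: "real \<Rightarrow> 'a::euclidean_space set" where
  "scaled_lattice \<delta> = {\<xi>. \<forall>b\<in>Basis. \<exists>k::int. \<xi> \<bullet> b = \<delta> * of_int k}"

lemma scaled_lattice_add: "\<xi> \<in> scaled_lattice \<delta> \<Longrightarrow> \<eta> \<in> scaled_lattice \<delta> \<Longrightarrow> \<xi> + \<eta> \<in> scaled_lattice \<delta>"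
  unfolding scaled_lattice_def
  by (auto simp: inner_add_left) (metis distrib_left of_int_add)

lemma scaled_lattice_minus: "\<xi> \<in> scaled_lattice \<delta> \<Longrightarrow> - \<xi> \<in> scaled_lattice \<delta>"
  unfolding scaled_lattice_def by (auto simp: inner_minus_left) (metis mult_minus_right of_int_minus)

definition centered_cube :: "real \<Rightarrow> 'a::euclidean_space set" where
  "centered_cube L = cbox (- (L / 2) *\<^sub>R One) ((L / 2) *\<^sub>R One)"

lemma mem_centered_cube: "x \<in> centered_cube L \<longleftrightarrow> (\<forall>b\<in>Basis. x \<bullet> b \<in> {- (L / 2)..L / 2})"
  unfolding centered_cube_def mem_box by simp

section \<open>Integrals of exponentials over the cube\<close>

lemma lborel_integral_prod:
  fixes f :: "'a::euclidean_space \<Rightarrow> real \<Rightarrow> complex"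
  assumes f: "\<And>b. b \<in> Basis \<Longrightarrow> integrable lborel (f b)"
  shows "(LINT x|lborel. (\<Prod>b\<in>Basis. f b (x \<bullet> b))) = (\<Prod>b\<in>Basis. (LINT t|lborel. f b t))"
proof -
  interpret product_sigma_finite "\<lambda>_::'a. lborel :: real measure" ..
  have [measurable]: "f b \<in> borel_measurable borel" if "b \<in> Basis" for b
    using borel_measurable_integrable[OF f[OF that]] by simp
  have "(LINT x|lborel. (\<Prod>b\<in>Basis. f b (x \<bullet> b))) =
      (LINT x|(\<Pi>\<^sub>M b\<in>Basis. lborel). (\<Prod>b\<in>Basis. f b ((\<Sum>b\<in>Basis. x b *\<^sub>R b) \<bullet> b)))"
    by (subst lborel_eq, rule integral_distr) measurable
  also have "\<dots> = (LINT x|(\<Pi>\<^sub>M b\<in>Basis. lborel). (\<Prod>b\<in>Basis. f b (x b)))"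
    by (intro Bochner_Integration.integral_cong prod.cong refl) simp
  also have "\<dots> = (\<Prod>b\<in>Basis. (LINT t|lborel. f b t))"
    by (rule product_integral_prod[OF finite_Basis f])
  finally show ?thesis .
qed

lemma integral_exp_period:
  assumes L: "L > 0"
  shows "(LINT t|lborel. indicator {- (L / 2)..L / 2} t *\<^sub>R exp (\<i> * of_real ((2 * pi / L * of_int k) * t))) =
    (if k = 0 then of_real L else 0)"
proof (cases "k = 0")
  case True
  then show ?thesis using L by (simp add: scaleR_conv_of_real)
next
  case False
  define a where "a = 2 * pi / L * of_int k"
  have a: "a \<noteq> 0" using L False by (simp add: a_def)
  define G where "G t = exp (\<i> * of_real (a * t)) / (\<i> * of_real a)" for t
  have "(LINT t|lborel. indicator {- (L / 2)..L / 2} t *\<^sub>R exp (\<i> * of_real (a * t))) = G (L / 2) - G (- (L / 2))"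
  proof (rule integral_FTC_Icc)
    fix t
    have "((\<lambda>z. exp (\<i> * (of_real a * z)) / (\<i> * of_real a)) has_field_derivative exp (\<i> * (of_real a * of_real t))) (at (of_real t))"
      using a by (auto intro!: derivative_eq_intros simp: field_simps)
    from has_vector_derivative_real_field[OF this]
    show "(G has_vector_derivative exp (\<i> * of_real (a * t))) (at t within {- (L / 2)..L / 2})"
      by (simp add: G_def[abs_def] has_vector_derivative_at_within)
  qed (use L in \<open>auto intro!: continuous_intros\<close>)
  also have "\<dots> = 0"
  proof -
    have "exp (\<i> * of_real (a * (L / 2))) = cis (pi * of_int k)" "exp (\<i> * of_real (a * - (L / 2))) = cis (- (pi * of_int k))"
      using L by (simp_all add: a_def cis_conv_exp)
    \<comment> \<open>The end points are an integer number of periods apart, so the antiderivative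
      takes the same value at both.\<close>
    moreover have "cis (pi * of_int k) = cis (- (pi * of_int k))"
      by (simp add: complex_eq_iff mult.commute)
    ultimately show ?thesis by (simp add: G_def)
  qed
  finally show ?thesis using False by (simp add: a_def)
qed

text \<open>The integral factorises over the coordinates; a nonzero lattice point has a nonzero
  coordinate, and the factor belonging to it is zero.\<close>

lemma integral_exp_cube:
  fixes \<zeta> :: "'a::euclidean_space"
  assumes L: "L > 0" and \<zeta>: "\<zeta> \<in> scaled_lattice (2 * pi / L)"
  shows "(LINT x:centered_cube L|lborel. exp (\<i> * of_real (\<zeta> \<bullet> x))) = (if \<zeta> = 0 then of_real (L ^ DIM('a)) else 0)"
proof -
  obtain k where k: "\<And>b. b \<in> Basis \<Longrightarrow> \<zeta> \<bullet> b = 2 * pi / L * of_int (k b)"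
    using \<zeta> unfolding scaled_lattice_def by simp metis
  define f where "f b t = indicator {- (L / 2)..L / 2} t *\<^sub>R exp (\<i> * of_real ((2 * pi / L * of_int (k b)) * t))" for b t
  have int: "integrable lborel (f b)" for b
    unfolding f_def[abs_def] by (rule borel_integrable_compact) (use L in \<open>auto intro!: continuous_intros\<close>)
  have "(LINT x:centered_cube L|lborel. exp (\<i> * of_real (\<zeta> \<bullet> x))) = (LINT x|lborel. (\<Prod>b\<in>Basis. f b (x \<bullet> b)))"
    unfolding set_lebesgue_integral_def
  proof (intro Bochner_Integration.integral_cong refl)
    fix x :: 'a
    have "exp (\<i> * of_real (\<zeta> \<bullet> x)) = exp (\<Sum>b\<in>Basis. \<i> * of_real ((\<zeta> \<bullet> b) * (x \<bullet> b)))"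
      by (subst euclidean_inner) (simp add: sum_distrib_left)
    also have "\<dots> = (\<Prod>b\<in>Basis. exp (\<i> * of_real ((2 * pi / L * of_int (k b)) * (x \<bullet> b))))"
      using k by (simp add: exp_sum)
    finally have e: "exp (\<i> * of_real (\<zeta> \<bullet> x)) = \<dots>" .
    show "indicator (centered_cube L) x *\<^sub>R exp (\<i> * of_real (\<zeta> \<bullet> x)) = (\<Prod>b\<in>Basis. f b (x \<bullet> b))"
    proof (cases "x \<in> centered_cube L")
      case True
      then have "f b (x \<bullet> b) = exp (\<i> * of_real ((2 * pi / L * of_int (k b)) * (x \<bullet> b)))" if "b \<in> Basis" for b
        using that by (auto simp: f_def mem_centered_cube)
      then show ?thesis using True unfolding e by (simp cong: prod.cong)
    next
      case False
      then obtain b where "b \<in> Basis" "x \<bullet> b \<notin> {- (L / 2)..L / 2}" by (auto simp: mem_centered_cube)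
      then have "b \<in> Basis" "f b (x \<bullet> b) = 0" by (auto simp: f_def)
      then show ?thesis using False by (auto intro!: prod_zero[symmetric])
    qed
  qed
  also have "\<dots> = (\<Prod>b\<in>Basis. if k b = 0 then of_real L else 0)"
  proof -
    have "(LINT t|lborel. f b t) = (if k b = 0 then of_real L else 0)" for b
      unfolding f_def by (rule integral_exp_period[OF L])
    then show ?thesis by (simp only: lborel_integral_prod[OF int])
  qed
  also have "\<dots> = (if \<zeta> = 0 then of_real (L ^ DIM('a)) else 0)"
  proof (cases "\<zeta> = 0")
    case True
    then have "k b = 0" if "b \<in> Basis" for b using k[OF that] L by (simp add: less_imp_neq[symmetric])
    then show ?thesis using True L by (simp cong: prod.cong)
  next
    case False
    then obtain b where "b \<in> Basis" "\<zeta> \<bullet> b \<noteq> 0" using euclidean_eq_iff[of \<zeta> 0] by auto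
    then have "b \<in> Basis" "k b \<noteq> 0" using k by auto
    then show ?thesis using False by (auto intro!: prod_zero)
  qed
  finally show ?thesis .
qed

section \<open>Orthogonality of the Hartley functions and Bessel's inequality\<close>

lemma centered_cube_bounded_borel: "bounded (centered_cube L)" "centered_cube L \<in> sets borel"
  by (simp_all add: centered_cube_def)

text \<open>Sums and differences of lattice points are lattice points, so the product formula
  reduces everything to real and imaginary parts of integrals of exponentials. These integrals are
  real at every frequency, hence no sine contributes.\<close>

lemma cas_orthogonal:
  fixes \<xi> \<eta> :: "'a::euclidean_space"
  assumes L: "L > 0" and \<xi>: "\<xi> \<in> scaled_lattice (2 * pi / L)" and \<eta>: "\<eta> \<in> scaled_lattice (2 * pi / L)"
  shows "(LINT x:centered_cube L|lborel. cas (\<xi> \<bullet> x) * cas (\<eta> \<bullet> x)) = L ^ DIM('a) * of_bool (\<xi> = \<eta>)"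
proof -
  have int: "set_integrable lborel (centered_cube L) (\<lambda>x::'a. exp (\<i> * of_real (\<zeta> \<bullet> x)))" for \<zeta>
    by (intro set_integrable_continuous_bounded centered_cube_bounded_borel continuous_intros)
  have cs: "(LINT x:centered_cube L|lborel. cos (\<zeta> \<bullet> x)) = L ^ DIM('a) * of_bool (\<zeta> = 0)"
     "(LINT x:centered_cube L|lborel. sin (\<zeta> \<bullet> x)) = 0"
    if "\<zeta> \<in> scaled_lattice (2 * pi / L)" for \<zeta> :: 'a
  proof -
    have "(LINT x:centered_cube L|lborel. cos (\<zeta> \<bullet> x)) = Re (LINT x:centered_cube L|lborel. exp (\<i> * of_real (\<zeta> \<bullet> x)))"
      using integral_Re[OF int[unfolded set_integrable_def], of \<zeta>] unfolding set_lebesgue_integral_def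
      by (simp add: Re_exp)
    then show "(LINT x:centered_cube L|lborel. cos (\<zeta> \<bullet> x)) = L ^ DIM('a) * of_bool (\<zeta> = 0)"
      unfolding integral_exp_cube[OF L that] by simp
    have "(LINT x:centered_cube L|lborel. sin (\<zeta> \<bullet> x)) = Im (LINT x:centered_cube L|lborel. exp (\<i> * of_real (\<zeta> \<bullet> x)))"
      using integral_Im[OF int[unfolded set_integrable_def], of \<zeta>] unfolding set_lebesgue_integral_def
      by (simp add: Im_exp)
    then show "(LINT x:centered_cube L|lborel. sin (\<zeta> \<bullet> x)) = 0"
      unfolding integral_exp_cube[OF L that] by simp
  qed
  have "(LINT x:centered_cube L|lborel. cas (\<xi> \<bullet> x) * cas (\<eta> \<bullet> x)) =
     (LINT x:centered_cube L|lborel. cos ((\<xi> - \<eta>) \<bullet> x) + sin ((\<xi> + \<eta>) \<bullet> x))"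
    by (simp add: cas_mult inner_diff_left inner_add_left)
  also have "\<dots> = (LINT x:centered_cube L|lborel. cos ((\<xi> - \<eta>) \<bullet> x)) + (LINT x:centered_cube L|lborel. sin ((\<xi> + \<eta>) \<bullet> x))"
    by (intro set_integral_add set_integrable_continuous_bounded centered_cube_bounded_borel continuous_intros)
  also have "\<dots> = L ^ DIM('a) * of_bool (\<xi> = \<eta>)"
    using cs scaled_lattice_add[OF \<xi> \<eta>] scaled_lattice_add[OF \<xi> scaled_lattice_minus[OF \<eta>]] by simp
  finally show ?thesis .
qed

lemma cas_sum_sq_cube:
  fixes \<xi> :: "nat \<Rightarrow> 'a::euclidean_space"
  assumes L: "L > 0" and \<xi>: "\<And>i. i < m \<Longrightarrow> \<xi> i \<in> scaled_lattice (2 * pi / L)" "inj_on \<xi> {..<m}"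
  shows "(LINT x:centered_cube L|lborel. (\<Sum>i<m. c i * cas (\<xi> i \<bullet> x))\<^sup>2) = L ^ DIM('a) * (\<Sum>i<m. (c i)\<^sup>2)"
proof -
  have "(LINT x:centered_cube L|lborel. (\<Sum>i<m. c i * cas (\<xi> i \<bullet> x))\<^sup>2) =
     (\<Sum>i<m. \<Sum>j<m. c i * c j * (LINT x:centered_cube L|lborel. cas (\<xi> i \<bullet> x) * cas (\<xi> j \<bullet> x)))"
    using set_integral_inner_sum[of m "\<lambda>i x. cas (\<xi> i \<bullet> x)" "centered_cube L" c c]
    by (simp add: power2_eq_square centered_cube_bounded_borel continuous_intros)
  also have "\<dots> = (\<Sum>i<m. \<Sum>j<m. if j = i then L ^ DIM('a) * (c i)\<^sup>2 else 0)"
    using cas_orthogonal[OF L \<xi>(1) \<xi>(1)] \<xi>(2)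
    by (intro sum.cong refl) (auto simp: power2_eq_square inj_on_def)
  also have "\<dots> = L ^ DIM('a) * (\<Sum>i<m. (c i)\<^sup>2)"
    by (simp add: sum_distrib_left)
  finally show ?thesis .
qed

text \<open>Bessel's inequality for the combination of the \<open>cas\<close> functions with
  coefficients \<open>c\<close>, cut off to \<open>F\<close> and extended by zero to the cube. Its
  coefficients against the orthogonal system are the \<open>a j\<close>, and \<open>N\<close> is the
  squared norm of each member. This supplies the weight bound of the variational principle with
  \<open>K = L ^ DIM('a)\<close>.\<close>

lemma cas_bessel:
  fixes \<xi> :: "nat \<Rightarrow> 'a::euclidean_space"
  assumes L: "L > 0" and \<xi>: "\<And>i. i < m \<Longrightarrow> \<xi> i \<in> scaled_lattice (2 * pi / L)" "inj_on \<xi> {..<m}"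
    and F: "F \<subseteq> centered_cube L" "F \<in> sets borel"
    and B: "\<And>i j. B i j = (LINT y:F|lborel. cas (\<xi> i \<bullet> y) * cas (\<xi> j \<bullet> y))"
  shows "(\<Sum>j<m. (\<Sum>i<m. c i * B i j)\<^sup>2) \<le> L ^ DIM('a) * (\<Sum>i<m. \<Sum>j<m. c i * c j * B i j)"
proof -
  define N where "N = L ^ DIM('a)"
  have N: "N > 0" using L by (simp add: N_def)
  have Fb: "bounded F" using F(1) centered_cube_bounded_borel(1) bounded_subset by blast
  have form: "(LINT y:F|lborel. (\<Sum>i<m. d i * cas (\<xi> i \<bullet> y)) * (\<Sum>i<m. e i * cas (\<xi> i \<bullet> y))) = (\<Sum>i<m. \<Sum>j<m. d i * e j * B i j)" for d e
    using set_integral_inner_sum[of m "\<lambda>i x. cas (\<xi> i \<bullet> x)" F d e] Fb F(2) by (simp add: B continuous_intros)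
  define a where "a j = (\<Sum>i<m. c i * B i j)" for j
  have Bsym: "B i j = B j i" for i j by (simp add: B mult.commute)
  \<comment> \<open>The subtracted combination, with coefficients \<open>a i / N\<close>, is the
    orthogonal projection in the cube. Its cross term equals the sum of the squares of the
    \<open>a j\<close> divided by \<open>N\<close> and occurs twice; its own square over
    \<open>F\<close> costs at most one of these.\<close>
  have "0 \<le> (LINT y:F|lborel. (\<Sum>i<m. (c i - a i / N) * cas (\<xi> i \<bullet> y)) * (\<Sum>i<m. (c i - a i / N) * cas (\<xi> i \<bullet> y)))"
    unfolding set_lebesgue_integral_def by (intro Bochner_Integration.integral_nonneg) auto
  also have "\<dots> = (\<Sum>i<m. \<Sum>j<m. (c i - a i / N) * (c j - a j / N) * B i j)"
    by (rule form)
  also have "\<dots> = (\<Sum>i<m. \<Sum>j<m. c i * c j * B i j) - (\<Sum>i<m. \<Sum>j<m. c i * (a j / N) * B i j)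
      - (\<Sum>i<m. \<Sum>j<m. c j * (a i / N) * B i j) + (\<Sum>i<m. \<Sum>j<m. (a i / N) * (a j / N) * B i j)"
    by (simp add: sum.distrib sum_subtractf left_diff_distrib right_diff_distrib mult_ac)
  also have "(\<Sum>i<m. \<Sum>j<m. c j * (a i / N) * B i j) = (\<Sum>i<m. \<Sum>j<m. c i * (a j / N) * B i j)"
    by (subst sum.swap) (simp add: Bsym)
  also have "(\<Sum>i<m. \<Sum>j<m. c i * (a j / N) * B i j) = (\<Sum>j<m. (a j)\<^sup>2) / N"
  proof -
    have "(\<Sum>i<m. \<Sum>j<m. c i * (a j / N) * B i j) = (\<Sum>j<m. \<Sum>i<m. (a j / N) * (c i * B i j))"
      by (subst sum.swap) (simp add: mult_ac)
    also have "\<dots> = (\<Sum>j<m. (a j / N) * a j)" by (simp only: sum_distrib_left[symmetric] a_def)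
    finally show ?thesis by (simp add: power2_eq_square sum_divide_distrib)
  qed
  also have "(\<Sum>i<m. \<Sum>j<m. (a i / N) * (a j / N) * B i j) = (LINT y:F|lborel. (\<Sum>i<m. a i / N * cas (\<xi> i \<bullet> y))\<^sup>2)"
    unfolding power2_eq_square by (rule form[symmetric])
  \<comment> \<open>Enlarging \<open>F\<close> to the cube makes the system orthogonal, so that the
    square can be evaluated.\<close>
  also have "\<dots> \<le> (LINT y:centered_cube L|lborel. (\<Sum>i<m. a i / N * cas (\<xi> i \<bullet> y))\<^sup>2)"
  proof -
    have "set_integrable lborel S (\<lambda>y. (\<Sum>i<m. a i / N * cas (\<xi> i \<bullet> y))\<^sup>2)" if "bounded S" "S \<in> sets borel" for S
      by (intro set_integrable_continuous_bounded that continuous_intros)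
    then have "integrable lborel (\<lambda>y. indicator F y *\<^sub>R (\<Sum>i<m. a i / N * cas (\<xi> i \<bullet> y))\<^sup>2)"
       "integrable lborel (\<lambda>y. indicator (centered_cube L) y *\<^sub>R (\<Sum>i<m. a i / N * cas (\<xi> i \<bullet> y))\<^sup>2)"
      using Fb F(2) centered_cube_bounded_borel unfolding set_integrable_def by blast+
    then show ?thesis
      unfolding set_lebesgue_integral_def using F(1) by (intro integral_mono) (auto simp: indicator_def)
  qed
  also have "\<dots> = N * (\<Sum>i<m. (a i / N)\<^sup>2)"
    unfolding N_def by (rule cas_sum_sq_cube[OF L \<xi>])
  also have "\<dots> = (\<Sum>j<m. (a j)\<^sup>2) / N"
    using N by (simp add: sum_distrib_left sum_divide_distrib power_divide power2_eq_square)
  finally have "(\<Sum>j<m. (a j)\<^sup>2) / N \<le> (\<Sum>i<m. \<Sum>j<m. c i * c j * B i j)" by simp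
  then show ?thesis using N by (simp add: a_def N_def[symmetric] field_simps)
qed

text \<open>Orthogonality speaks about the whole cube, whereas vanishing is known only on a possibly
  tiny \<open>U\<close>. Analyticity bridges the gap: the combination vanishes everywhere, and its
  norm over the cube then forces all coefficients to be zero.\<close>

lemma cas_independent_open:
  fixes \<xi> :: "nat \<Rightarrow> 'a::euclidean_space"
  assumes L: "L > 0" and \<xi>: "\<And>i. i < m \<Longrightarrow> \<xi> i \<in> scaled_lattice (2 * pi / L)" "inj_on \<xi> {..<m}"
    and U: "open U" "U \<noteq> {}" and zero: "\<And>x. x \<in> U \<Longrightarrow> (\<Sum>i<m. c i * cas (\<xi> i \<bullet> x)) = 0"
  shows "\<forall>i<m. c i = 0"
proof -
  obtain p where p: "p \<in> U" using U(2) by blast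
  have all0: "(\<Sum>i<m. c i * cas (\<xi> i \<bullet> q)) = 0" for q
  proof -
    \<comment> \<open>The restriction to the line from \<open>p\<close> to \<open>q\<close>,
      extended to a complex parameter: it vanishes for small real parameters, where the line is
      still in \<open>U\<close>, and its value at 1 is the one sought.\<close>
    define h where "h w = (\<Sum>i<m. of_real (c i) * (cos (of_real (\<xi> i \<bullet> p) + w * of_real (\<xi> i \<bullet> (q - p))) +
        sin (of_real (\<xi> i \<bullet> p) + w * of_real (\<xi> i \<bullet> (q - p)))))" for w :: complex
    have h: "h (of_real s) = of_real (\<Sum>i<m. c i * cas (\<xi> i \<bullet> (p + s *\<^sub>R (q - p))))" for s
      unfolding h_def cas_def
      by (simp add: inner_add_right cos_of_real[symmetric] sin_of_real[symmetric] del: cos_of_real sin_of_real)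
    have "open ((\<lambda>s. p + s *\<^sub>R (q - p)) -` U)"
      by (intro open_vimage U continuous_intros)
    moreover have "0 \<in> (\<lambda>s. p + s *\<^sub>R (q - p)) -` U" using p by simp
    ultimately obtain e where e: "e > 0" "ball 0 e \<subseteq> (\<lambda>s. p + s *\<^sub>R (q - p)) -` U"
      unfolding open_contains_ball by blast
    have "h 1 = 0"
    proof (rule analytic_continuation[of h UNIV "of_real ` {-e<..<e}" 0])
      show "h holomorphic_on UNIV" unfolding h_def by (intro holomorphic_intros)
      show "(0::complex) islimpt of_real ` {-e<..<e}"
        unfolding islimpt_approachable
      proof (intro allI impI)
        fix d :: real assume d: "d > 0"
        define s where "s = min d e / 2"
        have "0 < s" "s < d" "s < e" using d e(1) by (auto simp: s_def min_def)
        then show "\<exists>x'\<in>of_real ` {- e<..<e}. x' \<noteq> 0 \<and> dist x' (0::complex) < d"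
          by (intro bexI[of _ "of_real s :: complex"]) auto
      qed
      show "h z = 0" if "z \<in> of_real ` {-e<..<e}" for z
        using that e(2) zero by (force simp: h subset_iff abs_less_iff)
    qed auto
    then show ?thesis using h[of 1] by (simp del: of_real_sum)
  qed
  have "L ^ DIM('a) * (\<Sum>i<m. (c i)\<^sup>2) = 0"
    using cas_sum_sq_cube[OF L \<xi>, of c] by (simp add: all0 set_lebesgue_integral_def)
  moreover have "L ^ DIM('a) \<noteq> 0" using L by simp
  ultimately have "(\<Sum>i<m. (c i)\<^sup>2) = 0" by (metis mult_eq_0_iff)
  then show ?thesis by (subst (asm) sum_nonneg_eq_0_iff) auto
qed

text \<open>The points of \<open>U\<close> where \<open>f\<close> is nonzero form an open set, and a
  nonempty open set contains a ball of positive measure. This turns almost-everywhere vanishing, as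
  in \<open>H1_basis\<close>, into pointwise vanishing.\<close>

lemma AE_zero_open_continuous:
  fixes f :: "'b::euclidean_space \<Rightarrow> real"
  assumes AE: "AE x in lborel. x \<in> U \<longrightarrow> f x = 0" and U: "open U" and f: "continuous_on UNIV f" and x: "x \<in> U"
  shows "f x = 0"
proof (rule ccontr)
  assume "f x \<noteq> 0"
  have "open (U \<inter> {x. f x \<noteq> 0})"
    by (intro open_Int U open_Collect_neq f continuous_intros)
  then obtain e where e: "e > 0" "ball x e \<subseteq> U \<inter> {x. f x \<noteq> 0}"
    using x \<open>f x \<noteq> 0\<close> unfolding open_contains_ball by blast
  have "AE y in lborel. y \<notin> ball x e"
    using AE by eventually_elim (use e in auto)
  then have "emeasure lborel (ball x e) = 0"
    by (subst (asm) AE_iff_measurable[of "ball x e"]) auto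
  then have "measure lborel (ball x e) = 0" by (simp add: measure_def)
  then show False using content_ball_pos[of e x] e(1) by simp
qed

section \<open>The lattice estimate\<close>

lemma nn_integral_exp_Icc:
  assumes "r \<ge> 0" "h \<ge> 0"
  shows "(\<integral>\<^sup>+t. ennreal (2 * r\<^sup>2 * exp (2 * r * t)) * indicator {-h..0} t \<partial>lborel) = ennreal (r - r * exp (- (2 * r * h)))"
proof -
  have "(\<integral>\<^sup>+t. ennreal (2 * r\<^sup>2 * exp (2 * r * t)) * indicator {-h..0} t \<partial>lborel) =
      ennreal (r * exp (2 * r * 0) - r * exp (2 * r * (- h)))"
  proof (rule nn_integral_FTC_Icc)
    show "((\<lambda>t. r * exp (2 * r * t)) has_real_derivative 2 * r\<^sup>2 * exp (2 * r * t)) (at t)" for t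
      by (auto intro!: derivative_eq_intros simp: power2_eq_square)
  qed (use assms in auto)
  then show ?thesis by simp
qed

text \<open>\<Omega> is enlarged to the cylinder over \<open>F\<close>; the integrand ignores the
  horizontal variable, so Tonelli's theorem leaves the measure of \<open>F\<close> times an explicit
  vertical integral.\<close>

lemma integral_exp_snd_le:
  fixes \<Omega> :: "('a::euclidean_space \<times> real) set"
  assumes \<Omega>: "\<Omega> \<in> sets borel" "bounded \<Omega>" "\<Omega> \<subseteq> F \<times> {-h..0}" and F: "F \<in> sets borel" "bounded F"
    and r: "r \<ge> 0" and h: "h \<ge> 0"
  shows "(LINT x:\<Omega>|lborel. 2 * r\<^sup>2 * exp (2 * r * snd x)) \<le> measure lborel F * (r - r * exp (- (2 * r * h)))"
proof -
  have nonneg: "r - r * exp (- (2 * r * h)) \<ge> 0"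
    using r h by (simp add: mult_left_le)
  have int: "set_integrable lborel \<Omega> (\<lambda>x. 2 * r\<^sup>2 * exp (2 * r * snd x))"
    by (intro set_integrable_continuous_bounded \<Omega> continuous_intros)
  have "ennreal (LINT x:\<Omega>|lborel. 2 * r\<^sup>2 * exp (2 * r * snd x)) =
      (\<integral>\<^sup>+x. ennreal (indicator \<Omega> x *\<^sub>R (2 * r\<^sup>2 * exp (2 * r * snd x))) \<partial>lborel)"
    unfolding set_lebesgue_integral_def
    by (rule nn_integral_eq_integral[symmetric, OF int[unfolded set_integrable_def]]) simp
  also have "\<dots> \<le> (\<integral>\<^sup>+x. indicator F (fst x) * (ennreal (2 * r\<^sup>2 * exp (2 * r * snd x)) * indicator {-h..0} (snd x)) \<partial>lborel)"
    using \<Omega>(3) by (intro nn_integral_mono) (auto simp: indicator_def)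
  also have "\<dots> = (\<integral>\<^sup>+x. indicator F (fst x) * (ennreal (2 * r\<^sup>2 * exp (2 * r * snd x)) * indicator {-h..0} (snd x)) \<partial>(lborel \<Otimes>\<^sub>M lborel))"
    by (simp add: lborel_prod)
  also have "\<dots> = (\<integral>\<^sup>+y. (\<integral>\<^sup>+t. indicator F y * (ennreal (2 * r\<^sup>2 * exp (2 * r * t)) * indicator {-h..0} t) \<partial>lborel) \<partial>lborel)"
    using F by (subst lborel.nn_integral_fst[symmetric]) (auto simp: case_prod_beta)
  also have "\<dots> = (\<integral>\<^sup>+y. indicator F y * ennreal (r - r * exp (- (2 * r * h))) \<partial>lborel)"
    by (subst nn_integral_cmult) (simp_all add: nn_integral_exp_Icc r h)
  also have "\<dots> = emeasure lborel F * ennreal (r - r * exp (- (2 * r * h)))"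
    using F by (subst nn_integral_multc) auto
  also have "\<dots> = ennreal (measure lborel F * (r - r * exp (- (2 * r * h))))"
    using emeasure_bounded_finite[OF F(2)] nonneg
    by (simp add: ennreal_mult measure_nonneg emeasure_eq_ennreal_measure)
  finally show ?thesis
    using nonneg by (simp add: measure_nonneg)
qed

text \<open>Stated for any finite set of frequencies symmetric about the origin; symmetry is what
  cancels the odd parts of the boundary norms. The cutoff at radius \<open>z\<close> is chosen only
  in the final theorem.\<close>

lemma riesz_mean_ge_lattice:
  fixes \<Omega> :: "('a::euclidean_space \<times> real) set" and S :: "'a set"
  assumes \<Omega>: "open \<Omega>" "bounded \<Omega>" "\<Omega> \<noteq> {}" "\<Omega> \<subseteq> F \<times> {..<0}" and F: "F \<in> sets borel" "bounded F"
    and h: "h \<ge> 0" "\<And>x. x \<in> \<Omega> \<Longrightarrow> \<bar>snd x\<bar> \<le> h"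
    and L: "L > 0" "F \<subseteq> centered_cube L"
    and S: "finite S" "S \<subseteq> scaled_lattice (2 * pi / L)" "uminus ` S = S"
  shows "ennreal (measure lborel F / L ^ DIM('a) * (\<Sum>\<xi>\<in>S. z - norm \<xi> + norm \<xi> * exp (- (2 * norm \<xi> * h))))
    \<le> riesz_mean_1 \<Omega> F z"
proof -
  obtain \<xi> :: "nat \<Rightarrow> 'a" where bij: "bij_betw \<xi> {..<card S} S"
    using ex_bij_betw_nat_finite[OF S(1)] by (auto simp: atLeast0LessThan)
  define m where "m = card S"
  have inj: "inj_on \<xi> {..<m}" and \<xi>: "\<And>i. i < m \<Longrightarrow> \<xi> i \<in> scaled_lattice (2 * pi / L)"
    using bij S(2) unfolding m_def bij_betw_def by auto
  define v where "v i x = exp (norm (\<xi> i) * snd x) * (1 * cos (\<xi> i \<bullet> fst x) + 1 * sin (\<xi> i \<bullet> fst x))" for i and x :: "'a \<times> real"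
  define g where "g i x = (exp (norm (\<xi> i) * snd x) * (1 * cos (\<xi> i \<bullet> fst x) + (- 1) * sin (\<xi> i \<bullet> fst x))) *\<^sub>R (\<xi> i, 0) +
    (exp (norm (\<xi> i) * snd x) * ((norm (\<xi> i) * 1) * cos (\<xi> i \<bullet> fst x) + (norm (\<xi> i) * 1) * sin (\<xi> i \<bullet> fst x))) *\<^sub>R (0, 1::real)"
    for i and x :: "'a \<times> real"
  define A where "A i j = (LINT x:\<Omega>|lborel. g i x \<bullet> g j x)" for i j
  define B where "B i j = (LINT y:F|lborel. cas (\<xi> i \<bullet> y) * cas (\<xi> j \<bullet> y))" for i j
  have v_eq: "v i x = exp (norm (\<xi> i) * snd x) * cas (\<xi> i \<bullet> fst x)" for i x
    by (simp add: v_def cas_def)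
  have sv: "smooth_on UNIV (v i)" for i unfolding v_def by (rule smooth_exp_trig)
  have gv: "GDERIV (v i) x :> g i x" for i x unfolding v_def g_def by (rule GDERIV_exp_trig)
  have cv: "continuous_on UNIV (v i)" for i using sv unfolding smooth_on_def by (metis C_k_on.simps(1))
  have trial: "ennreal ((\<Sum>j<m. z * B j j - A j j) / L ^ DIM('a)) \<le> riesz_mean_1 \<Omega> F z"
  proof (rule riesz_mean_ge_trial[where A = A and B = B, OF \<Omega>(1,2) F(2,1) sv gv _ A_def])
    fix c
    assume AE: "AE x in lborel. x \<in> \<Omega> \<longrightarrow> (\<Sum>i<m. c i * v i x) = 0"
    have zero: "(\<Sum>i<m. c i * v i x) = 0" if "x \<in> \<Omega>" for x
      by (rule AE_zero_open_continuous[OF AE \<Omega>(1) _ that]) (intro continuous_intros cv)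
    obtain p t where pt: "(p, t) \<in> \<Omega>" using \<Omega>(3) by auto
    \<comment> \<open>On a horizontal slice of \<Omega> the exponentials are constants and can be
      absorbed into the coefficients.\<close>
    have "\<forall>i<m. c i * exp (norm (\<xi> i) * t) = 0"
    proof (rule cas_independent_open[OF L(1) \<xi> inj])
      have "(\<lambda>y. (y, t)) -` \<Omega> = {y. (y, t) \<in> \<Omega>}" by auto
      then show "open {y. (y, t) \<in> \<Omega>}"
        using open_vimage[OF \<Omega>(1), of "\<lambda>y. (y, t)"] by (simp add: continuous_intros)
      show "{y. (y, t) \<in> \<Omega>} \<noteq> {}" using pt by auto
      show "(\<Sum>i<m. c i * exp (norm (\<xi> i) * t) * cas (\<xi> i \<bullet> x)) = 0" if "x \<in> {y. (y, t) \<in> \<Omega>}" for x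
        using zero[of "(x, t)"] that by (simp add: v_eq mult_ac)
    qed
    then show "\<forall>i<m. c i = 0" by simp
  next
    show "B i j = (LINT y:F|lborel. v i (y, 0) * v j (y, 0))" for i j
      by (simp add: B_def v_eq)
  next
    fix c :: "nat \<Rightarrow> real" assume c: "\<exists>i<m. c i \<noteq> 0"
    let ?w = "\<lambda>y. \<Sum>i<m. c i * cas (\<xi> i \<bullet> y)"
    have eq: "(\<Sum>i<m. \<Sum>j<m. c i * c j * B i j) = (LINT y:F|lborel. ?w y * ?w y)"
      using set_integral_inner_sum[of m "\<lambda>i x. cas (\<xi> i \<bullet> x)" F c c] F by (simp add: B_def continuous_intros)
    have int: "set_integrable lborel F (\<lambda>y. ?w y * ?w y)"
      by (intro set_integrable_continuous_bounded F continuous_intros)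
    have "(LINT y:F|lborel. ?w y * ?w y) \<noteq> 0"
    proof
      assume "(LINT y:F|lborel. ?w y * ?w y) = 0"
      then have "AE y in lborel. indicator F y *\<^sub>R (?w y * ?w y) = 0"
        using int unfolding set_lebesgue_integral_def set_integrable_def
        by (subst (asm) integral_nonneg_eq_0_iff_AE) auto
      \<comment> \<open>\<open>F\<close> is only known to be Borel, but it contains the projection
        of \<Omega>, which is open and nonempty; independence is applied there.\<close>
      then have AE: "AE y in lborel. y \<in> fst ` \<Omega> \<longrightarrow> ?w y = 0"
        by eventually_elim (use \<Omega>(4) in \<open>auto simp: indicator_def split: if_splits\<close>)
      have "\<forall>i<m. c i = 0"
      proof (rule cas_independent_open[OF L(1) \<xi> inj open_image_fst[OF \<Omega>(1)]])
        show "fst ` \<Omega> \<noteq> {}" using \<Omega>(3) by simp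
        show "?w x = 0" if "x \<in> fst ` \<Omega>" for x
          by (rule AE_zero_open_continuous[OF AE open_image_fst[OF \<Omega>(1)] _ that]) (intro continuous_intros)
      qed
      then show False using c by blast
    qed
    moreover have "(LINT y:F|lborel. ?w y * ?w y) \<ge> 0"
      unfolding set_lebesgue_integral_def by (intro Bochner_Integration.integral_nonneg) auto
    ultimately show "(\<Sum>i<m. \<Sum>j<m. c i * c j * B i j) > 0" unfolding eq by simp
  next
    show "(\<Sum>j<m. (\<Sum>i<m. c i * B i j)\<^sup>2) \<le> L ^ DIM('a) * (\<Sum>i<m. \<Sum>j<m. c i * c j * B i j)" for c
      by (rule cas_bessel[OF L(1) \<xi> inj L(2) F(1) B_def])
  qed (use L in auto)
  \<comment> \<open>\<open>s\<close> is the odd part of the squared boundary norm as a function of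
    the frequency.\<close>
  define s where "s \<xi> = (LINT y:F|lborel. sin (\<xi> \<bullet> y + \<xi> \<bullet> y))" for \<xi> :: 'a
  have "(\<Sum>\<xi>\<in>S. s \<xi>) = (\<Sum>\<xi>\<in>uminus ` S. s \<xi>)" using S(3) by simp
  also have "\<dots> = (\<Sum>\<xi>\<in>S. s (- \<xi>))" by (subst sum.reindex) auto
  also have "\<dots> = - (\<Sum>\<xi>\<in>S. s \<xi>)"
  proof -
    have "s (- \<xi>) = - s \<xi>" for \<xi>
      unfolding s_def set_lebesgue_integral_def
      by (subst Bochner_Integration.integral_minus[symmetric]) (simp add: sin_add)
    then show ?thesis by (simp add: sum_negf)
  qed
  finally have s0: "(\<Sum>\<xi>\<in>S. s \<xi>) = 0" by simp
  have Bjj: "B j j = measure lborel F + s (\<xi> j)" for j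
  proof -
    have "B j j = (LINT y:F|lborel. 1 + sin (\<xi> j \<bullet> y + \<xi> j \<bullet> y))"
      by (simp add: B_def cas_mult)
    also have "\<dots> = (LINT y:F|lborel. 1) + s (\<xi> j)"
      unfolding s_def by (intro set_integral_add set_integrable_continuous_bounded F continuous_intros)
    finally show ?thesis by (simp add: set_lebesgue_integral_def)
  qed
  have Ajj: "A j j \<le> measure lborel F * (norm (\<xi> j) - norm (\<xi> j) * exp (- (2 * norm (\<xi> j) * h)))" for j
  proof -
    \<comment> \<open>The horizontal part carries cos - sin and the vertical part cos + sin, with
      the same factor, so the mixed terms cancel.\<close>
    have ring_id: "(E * (c - s))\<^sup>2 * r\<^sup>2 + (E * (r * c + r * s))\<^sup>2 = 2 * r\<^sup>2 * (E * E) * (s\<^sup>2 + c\<^sup>2)" for E c s r :: real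
      by (simp add: power2_eq_square algebra_simps)
    have "g j x \<bullet> g j x = 2 * (norm (\<xi> j))\<^sup>2 * exp (2 * norm (\<xi> j) * snd x)" for x
    proof -
      let ?r = "norm (\<xi> j)" and ?E = "exp (norm (\<xi> j) * snd x)" and ?c = "cos (\<xi> j \<bullet> fst x)" and ?s = "sin (\<xi> j \<bullet> fst x)"
      have "g j x \<bullet> g j x = (?E * (?c - ?s))\<^sup>2 * ?r\<^sup>2 + (?E * (?r * ?c + ?r * ?s))\<^sup>2"
        by (simp add: g_def inner_prod_def dot_square_norm power2_eq_square)
      also have "\<dots> = 2 * ?r\<^sup>2 * (?E * ?E) * (?s\<^sup>2 + ?c\<^sup>2)"
        by (rule ring_id)
      also have "?E * ?E = exp (2 * ?r * snd x)" by (simp flip: exp_add)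
      finally show ?thesis by simp
    qed
    then have "A j j = (LINT x:\<Omega>|lborel. 2 * (norm (\<xi> j))\<^sup>2 * exp (2 * norm (\<xi> j) * snd x))"
      by (simp add: A_def)
    also have "\<dots> \<le> measure lborel F * (norm (\<xi> j) - norm (\<xi> j) * exp (- (2 * norm (\<xi> j) * h)))"
    proof (rule integral_exp_snd_le)
      show "\<Omega> \<subseteq> F \<times> {-h..0}" using \<Omega>(4) h(2) by fastforce
    qed (use \<Omega> F h in auto)
    finally show ?thesis .
  qed
  let ?G = "\<lambda>\<xi>::'a. z - norm \<xi> + norm \<xi> * exp (- (2 * norm \<xi> * h))"
  \<comment> \<open>A zero is added so that the comparison with the trial functions can be made term
    by term, odd parts included.\<close>
  have "measure lborel F * (\<Sum>\<xi>\<in>S. ?G \<xi>) = measure lborel F * (\<Sum>\<xi>\<in>S. ?G \<xi>) + z * (\<Sum>\<xi>\<in>S. s \<xi>)"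
    by (simp only: s0 mult_zero_right add_0_right)
  also have "\<dots> = (\<Sum>\<xi>\<in>S. measure lborel F * ?G \<xi> + z * s \<xi>)"
    unfolding sum_distrib_left by (rule sum.distrib[symmetric])
  also have "\<dots> = (\<Sum>j<m. measure lborel F * ?G (\<xi> j) + z * s (\<xi> j))"
    unfolding m_def by (rule sum.reindex_bij_betw[OF bij, symmetric])
  also have "\<dots> \<le> (\<Sum>j<m. z * B j j - A j j)"
  proof (intro sum_mono)
    fix j
    show "measure lborel F * ?G (\<xi> j) + z * s (\<xi> j) \<le> z * B j j - A j j"
      using Ajj[of j] by (simp add: Bjj algebra_simps)
  qed
  finally have "measure lborel F / L ^ DIM('a) * (\<Sum>\<xi>\<in>S. ?G \<xi>) \<le> (\<Sum>j<m. z * B j j - A j j) / L ^ DIM('a)"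
    using L(1) by (simp add: divide_right_mono)
  then show ?thesis using trial by (meson ennreal_leI order_trans)
qed

section \<open>Passage to the limit\<close>

lemma finite_scaled_lattice_ball:
  assumes "\<delta> > 0"
  shows "finite {\<xi> \<in> scaled_lattice \<delta>. norm (\<xi> :: 'a::euclidean_space) < z}"
proof (rule finite_subset)
  define M where "M = \<lceil>z / \<delta>\<rceil>"
  let ?P = "PiE (Basis :: 'a set) (\<lambda>_. {-M..M})"
  show "finite ((\<lambda>k. \<Sum>b\<in>Basis. (\<delta> * of_int (k b)) *\<^sub>R b) ` ?P)"
    by (intro finite_imageI finite_PiE) auto
  show "{\<xi> \<in> scaled_lattice \<delta>. norm \<xi> < z} \<subseteq> (\<lambda>k. \<Sum>b\<in>Basis. (\<delta> * of_int (k b)) *\<^sub>R b) ` ?P"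
  proof
    fix \<xi> :: 'a assume "\<xi> \<in> {\<xi> \<in> scaled_lattice \<delta>. norm \<xi> < z}"
    then obtain k where k: "\<And>b. b \<in> Basis \<Longrightarrow> \<xi> \<bullet> b = \<delta> * of_int (k b)" and n: "norm \<xi> < z"
      unfolding scaled_lattice_def by simp metis
    have "k b \<in> {-M..M}" if b: "b \<in> Basis" for b
    proof -
      have "\<bar>\<delta> * of_int (k b)\<bar> < z" using Basis_le_norm[OF b, of \<xi>] k[OF b] n by simp
      then have "\<bar>of_int (k b)\<bar> < z / \<delta>" using assms by (simp add: abs_mult field_simps)
      then have "of_int \<bar>k b\<bar> \<le> (of_int M :: real)" unfolding M_def by linarith
      then have "\<bar>k b\<bar> \<le> M" by (simp only: of_int_le_iff)
      then show ?thesis by auto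
    qed
    then have "restrict k Basis \<in> ?P" by auto
    moreover have "\<xi> = (\<Sum>b\<in>Basis. (\<delta> * of_int (restrict k Basis b)) *\<^sub>R b)"
      by (subst euclidean_representation[symmetric]) (simp add: k)
    ultimately show "\<xi> \<in> (\<lambda>k. \<Sum>b\<in>Basis. (\<delta> * of_int (k b)) *\<^sub>R b) ` ?P" by blast
  qed
qed

text \<open>The integrand may jump at the sphere of radius \<open>z\<close>, but the cutoff is to
  the open ball and \<open>g\<close> is nonnegative there, so the integrand is lower semicontinuous.
  A pointwise lower bound for the liminf of step functions then suffices, by Fatou's lemma.\<close>

lemma lattice_riemann_sum_liminf:
  fixes g :: "real \<Rightarrow> real" and \<delta> :: "nat \<Rightarrow> real"
  assumes g: "continuous_on UNIV g" "\<And>r. 0 \<le> r \<Longrightarrow> r < z \<Longrightarrow> 0 \<le> g r"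
    and \<delta>: "\<And>N. \<delta> N > 0" "\<delta> \<longlonglongrightarrow> 0"
  shows "(\<integral>\<^sup>+x. (if norm x < z then ennreal (g (norm x)) else 0) \<partial>(lborel :: 'a::euclidean_space measure)) \<le>
    liminf (\<lambda>N. ennreal (\<delta> N ^ DIM('a) * (\<Sum>\<xi> | \<xi> \<in> scaled_lattice (\<delta> N) \<and> norm (\<xi>::'a) < z. g (norm \<xi>))))"
proof -
  define f where "f x = (if norm x < z then ennreal (g (norm x)) else 0)" for x :: 'a
  define S where "S N = {\<xi> \<in> scaled_lattice (\<delta> N). norm (\<xi>::'a) < z}" for N
  have finS: "finite (S N)" for N unfolding S_def by (rule finite_scaled_lattice_ball[OF \<delta>(1)])
  \<comment> \<open>Closed cells overlap along their faces; this can only increase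
    \<open>R N\<close> at a point, and the integral is still the exact Riemann sum.\<close>
  define R where "R N x = (\<Sum>\<xi>\<in>S N. ennreal (g (norm \<xi>)) * indicator (cbox \<xi> (\<xi> + \<delta> N *\<^sub>R One)) x)" for N and x :: 'a
  \<comment> \<open>The lower corner of the lattice cell containing \<open>x\<close>.\<close>
  define \<rho> where "\<rho> N x = (\<Sum>b\<in>Basis. (\<delta> N * of_int \<lfloor>(x \<bullet> b) / \<delta> N\<rfloor>) *\<^sub>R b)" for N and x :: 'a
  have \<rho>b: "\<rho> N x \<bullet> b = \<delta> N * of_int \<lfloor>(x \<bullet> b) / \<delta> N\<rfloor>" if "b \<in> Basis" for N x b
    using that by (simp add: \<rho>_def)
  have \<rho>_bounds: "\<rho> N x \<bullet> b \<le> x \<bullet> b" "x \<bullet> b \<le> \<rho> N x \<bullet> b + \<delta> N" if "b \<in> Basis" for N x b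
  proof -
    have "of_int \<lfloor>(x \<bullet> b) / \<delta> N\<rfloor> * \<delta> N \<le> x \<bullet> b"
      using of_int_floor_le[of "(x \<bullet> b) / \<delta> N"] unfolding pos_le_divide_eq[OF \<delta>(1)] .
    then show "\<rho> N x \<bullet> b \<le> x \<bullet> b" by (simp only: \<rho>b[OF that] mult.commute)
    have "x \<bullet> b \<le> (of_int \<lfloor>(x \<bullet> b) / \<delta> N\<rfloor> + 1) * \<delta> N"
      using real_of_int_floor_add_one_ge[of "(x \<bullet> b) / \<delta> N"] unfolding pos_divide_le_eq[OF \<delta>(1)] .
    then show "x \<bullet> b \<le> \<rho> N x \<bullet> b + \<delta> N" by (simp add: \<rho>b[OF that] algebra_simps)
  qed
  have fR: "f (\<rho> N x) \<le> R N x" for N x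
  proof (cases "norm (\<rho> N x) < z")
    case True
    then have "\<rho> N x \<in> S N" unfolding S_def scaled_lattice_def using \<rho>b by blast
    moreover have "x \<in> cbox (\<rho> N x) (\<rho> N x + \<delta> N *\<^sub>R One)"
      using \<rho>_bounds by (simp add: mem_box inner_add_left)
    ultimately have "f (\<rho> N x) = ennreal (g (norm (\<rho> N x))) * indicator (cbox (\<rho> N x) (\<rho> N x + \<delta> N *\<^sub>R One)) x"
      and "\<rho> N x \<in> S N"
      using True by (simp_all add: f_def)
    then show ?thesis
      using finS member_le_sum[where i = "\<rho> N x" and A = "S N" and f = "\<lambda>\<xi>. ennreal (g (norm \<xi>)) * indicator (cbox \<xi> (\<xi> + \<delta> N *\<^sub>R One)) x"]
      unfolding R_def by simp
  qed (simp add: f_def)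
  have lim\<rho>: "(\<lambda>N. \<rho> N x) \<longlonglongrightarrow> x" for x
  proof -
    have "(\<lambda>N. norm (\<rho> N x - x)) \<longlonglongrightarrow> 0"
    proof (rule tendsto_sandwich[OF _ _ tendsto_const])
      show "eventually (\<lambda>N. norm (\<rho> N x - x) \<le> real DIM('a) * \<delta> N) sequentially"
      proof (intro always_eventually allI)
        fix N
        have "norm (\<rho> N x - x) \<le> (\<Sum>b\<in>Basis. \<bar>(\<rho> N x - x) \<bullet> b\<bar>)" by (rule norm_le_l1)
        also have "\<dots> \<le> (\<Sum>b\<in>(Basis::'a set). \<delta> N)"
        proof (rule sum_mono)
          fix b :: 'a assume "b \<in> Basis"
          then show "\<bar>(\<rho> N x - x) \<bullet> b\<bar> \<le> \<delta> N"
            using \<rho>_bounds[where b = b and N = N and x = x] by (simp add: inner_diff_left abs_le_iff)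
        qed
        finally show "norm (\<rho> N x - x) \<le> real DIM('a) * \<delta> N" by simp
      qed
      show "(\<lambda>N. real DIM('a) * \<delta> N) \<longlonglongrightarrow> 0" using tendsto_mult_right_zero[OF \<delta>(2)] .
    qed simp
    then show ?thesis by (simp add: tendsto_norm_zero_iff LIM_zero_iff)
  qed
  \<comment> \<open>Inside the ball the strict inequality passes to \<open>\<rho> N x\<close> for
    large \<open>N\<close>; elsewhere \<open>f x\<close> is 0.\<close>
  have fle: "f x \<le> liminf (\<lambda>N. R N x)" for x
  proof (cases "norm x < z")
    case True
    have "eventually (\<lambda>N. norm (\<rho> N x) < z) sequentially"
      using tendsto_norm[OF lim\<rho>[of x]] True by (rule order_tendstoD(2))
    then have ev: "eventually (\<lambda>N. ennreal (g (norm (\<rho> N x))) \<le> R N x) sequentially"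
      by eventually_elim (use fR in \<open>metis f_def\<close>)
    have "isCont g (norm x)" using g(1) by (simp add: continuous_on_eq_continuous_at)
    then have "(\<lambda>N. ennreal (g (norm (\<rho> N x)))) \<longlonglongrightarrow> ennreal (g (norm x))"
      by (intro tendsto_ennrealI isCont_tendsto_compose[of _ g] tendsto_norm lim\<rho>)
    then have "f x = liminf (\<lambda>N. ennreal (g (norm (\<rho> N x))))"
      using True by (simp add: f_def lim_imp_Liminf)
    also have "\<dots> \<le> liminf (\<lambda>N. R N x)" by (rule Liminf_mono[OF ev])
    finally show ?thesis .
  qed (simp add: f_def)
  have "(\<integral>\<^sup>+x. f x \<partial>lborel) \<le> (\<integral>\<^sup>+x. liminf (\<lambda>N. R N x) \<partial>lborel)"
    by (intro nn_integral_mono fle)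
  also have "\<dots> \<le> liminf (\<lambda>N. \<integral>\<^sup>+x. R N x \<partial>lborel)"
    by (rule nn_integral_liminf) (simp add: R_def)
  also have "(\<lambda>N. \<integral>\<^sup>+x. R N x \<partial>lborel) = (\<lambda>N. ennreal (\<delta> N ^ DIM('a) * (\<Sum>\<xi>\<in>S N. g (norm \<xi>))))"
  proof
    fix N
    have g0: "0 \<le> g (norm \<xi>)" if "\<xi> \<in> S N" for \<xi> using that g(2) by (simp add: S_def)
    have "(\<integral>\<^sup>+x. R N x \<partial>lborel) = (\<Sum>\<xi>\<in>S N. ennreal (g (norm \<xi>)) * emeasure lborel (cbox \<xi> (\<xi> + \<delta> N *\<^sub>R One)))"
      unfolding R_def by (simp add: nn_integral_sum nn_integral_cmult)
    also have "\<dots> = (\<Sum>\<xi>\<in>S N. ennreal (\<delta> N ^ DIM('a) * g (norm \<xi>)))"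
    proof (intro sum.cong refl)
      fix \<xi> assume "\<xi> \<in> S N"
      have "emeasure lborel (cbox \<xi> (\<xi> + \<delta> N *\<^sub>R One)) = ennreal (\<delta> N ^ DIM('a))"
        using \<delta>(1)[of N] by (subst emeasure_lborel_cbox) (simp_all add: inner_add_left)
      then show "ennreal (g (norm \<xi>)) * emeasure lborel (cbox \<xi> (\<xi> + \<delta> N *\<^sub>R One)) = ennreal (\<delta> N ^ DIM('a) * g (norm \<xi>))"
        using \<delta>(1)[of N] g0[OF \<open>\<xi> \<in> S N\<close>] by (simp add: ennreal_mult mult.commute)
    qed
    also have "\<dots> = ennreal (\<delta> N ^ DIM('a) * (\<Sum>\<xi>\<in>S N. g (norm \<xi>)))"
      using \<delta>(1)[of N] g0 by (subst sum_ennreal) (auto simp: sum_distrib_left)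
    finally show "(\<integral>\<^sup>+x. R N x \<partial>lborel) = ennreal (\<delta> N ^ DIM('a) * (\<Sum>\<xi>\<in>S N. g (norm \<xi>)))" .
  qed
  finally show ?thesis unfolding f_def S_def by simp
qed

text \<open>A telescoping sum: each further term of the exponential series cancels the remainder
  left by the previous ones. Together with the value at 0, this identifies Gamma(n) - Gamma(n, x) as
  the integral of t^(n-1) exp(-t) from 0 to x.\<close>

lemma DERIV_incomplete_Gamma:
  "((\<lambda>x. incomplete_Gamma (Suc d) x) has_real_derivative - (x ^ d * exp (- x))) (at x)"
proof -
  have "((\<lambda>x. exp (- x) * (\<Sum>k<Suc d. x ^ k / fact k)) has_real_derivative - (x ^ d * exp (- x) / fact d)) (at x)"
  proof (induction d)
    case 0
    show ?case by (auto intro!: derivative_eq_intros)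
  next
    case (Suc d)
    have pow: "((\<lambda>x. x ^ Suc d) has_real_derivative real (Suc d) * x ^ d) (at x)"
      using DERIV_pow[of "Suc d" x] by simp
    have ex: "((\<lambda>x. exp (- x)) has_real_derivative - exp (- x)) (at x)"
      by (auto intro!: derivative_eq_intros)
    have "((\<lambda>x. exp (- x) * (x ^ Suc d / fact (Suc d))) has_real_derivative
        - exp (- x) * (x ^ Suc d / fact (Suc d)) + (real (Suc d) * x ^ d / fact (Suc d)) * exp (- x)) (at x)"
      by (rule DERIV_mult[OF ex DERIV_cdivide[OF pow]])
    moreover have "real (Suc d) * x ^ d / fact (Suc d) = x ^ d / fact d"
      by (simp del: of_nat_Suc)
    ultimately have "((\<lambda>x. exp (- x) * (x ^ Suc d / fact (Suc d))) has_real_derivative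
        - exp (- x) * (x ^ Suc d / fact (Suc d)) + (x ^ d / fact d) * exp (- x)) (at x)"
      by (simp only:)
    from DERIV_add[OF Suc.IH this]
    have "((\<lambda>x. exp (- x) * (\<Sum>k<Suc d. x ^ k / fact k) + exp (- x) * (x ^ Suc d / fact (Suc d))) has_real_derivative
       - (x ^ Suc d * exp (- x) / fact (Suc d))) (at x)"
      by (simp only: algebra_simps) simp
    then show ?case by (simp only: sum.lessThan_Suc[of _ "Suc d"] distrib_left)
  qed
  from DERIV_cmult[OF this, of "fact d"] show ?thesis
    unfolding incomplete_Gamma_def by (simp add: mult.assoc)
qed

lemma incomplete_Gamma_0: "incomplete_Gamma (Suc d) 0 = Gamma (real (Suc d))"
proof -
  have "(\<Sum>k<Suc d. (0::real) ^ k / fact k) = 1"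
    by (subst sum.lessThan_Suc_shift) simp
  then show ?thesis
    using Gamma_fact[of d, where 'a = real] by (simp add: incomplete_Gamma_def add.commute)
qed

text \<open>Layer-cake integration: \<open>g r = z - r + r e\<^sup>-\<^sup>2\<^sup>h\<^sup>r\<close> is decreasing, so
  \<open>g \<bar>x\<bar> = g z + \<integral>\<^bsub>\<bar>x\<bar>\<^esub>\<^bsup>z\<^esup> (- g' s) ds\<close>, and Tonelli's theorem turns the inner integral over \<open>x\<close>
  into the volume of a ball of radius \<open>s\<close>.\<close>

lemma radial_integral_ge:
  fixes h z :: real
  assumes h: "h > 0" and z: "z > 0"
  defines "d \<equiv> DIM('a::euclidean_space)"
  defines "g \<equiv> \<lambda>r. z - r + r * exp (- (2 * r * h))"
  shows "ennreal (unit_ball_vol (real d) * (z ^ Suc d / real (Suc d) +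
      real d / (2 * h) ^ Suc d * (Gamma (real (Suc d)) - incomplete_Gamma (Suc d) (2 * h * z)))) \<le>
    (\<integral>\<^sup>+x. (if norm x < z then ennreal (g (norm x)) else 0) \<partial>(lborel :: 'a measure))"
proof -
  \<comment> \<open>\<open>k\<close> is minus the derivative of \<open>g\<close>.\<close>
  define k where "k s = 1 - exp (- (2 * s * h)) * (1 - 2 * s * h)" for s
  define V where "V = unit_ball_vol (real d)"
  have V: "V \<ge> 0" by (simp add: V_def)
  have d: "d > 0" by (simp add: d_def)
  have dg: "(g has_real_derivative - k s) (at s)" for s
    unfolding g_def k_def by (auto intro!: derivative_eq_intros simp: algebra_simps)
  have k0: "k s \<ge> 0" if "s \<ge> 0" for s
  proof -
    have "exp (- (2 * s * h)) * (1 - 2 * s * h) \<le> exp (- (2 * s * h)) * 1"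
      using that h by (intro mult_left_mono) auto
    also have "\<dots> \<le> 1" using that h by simp
    finally show ?thesis by (simp add: k_def)
  qed
  have [measurable]: "k \<in> borel_measurable borel"
    unfolding k_def by measurable
  have gz: "g z \<ge> 0" using z by (simp add: g_def)
  let ?K = "\<lambda>x s. ennreal (k s) * indicator {0..<z} s * indicator {p. norm (fst p) \<le> snd p} (x :: 'a, s)"
  have point: "ennreal (g z) * indicator (ball 0 z) x + (\<integral>\<^sup>+s. ?K x s \<partial>lborel) \<le>
      (if norm x < z then ennreal (g (norm x)) else 0)" for x :: 'a
  proof (cases "norm x < z")
    case True
    have "(\<integral>\<^sup>+s. ?K x s \<partial>lborel) \<le> (\<integral>\<^sup>+s. ennreal (k s) * indicator {norm x..z} s \<partial>lborel)"
      by (intro nn_integral_mono) (auto simp: indicator_def)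
    also have "\<dots> = ennreal (- g z - (- g (norm x)))"
    proof (rule nn_integral_FTC_Icc)
      show "((\<lambda>s. - g s) has_real_derivative k s) (at s)" for s
        using DERIV_minus[OF dg[of s]] by simp
      show "0 \<le> k s" if "s \<in> {norm x..z}" for s
        using that by (intro k0) (auto intro: order_trans[OF norm_ge_zero])
    qed (use True in auto)
    finally have le: "(\<integral>\<^sup>+s. ?K x s \<partial>lborel) \<le> ennreal (g (norm x) - g z)" by simp
    have mono: "g z \<le> g (norm x)"
    proof (rule DERIV_nonpos_imp_nonincreasing[of "norm x" z g])
      show "\<exists>y. (g has_real_derivative y) (at s) \<and> y \<le> 0" if "norm x \<le> s" for s
        using dg k0[OF order_trans[OF norm_ge_zero that]] by (intro exI[of _ "- k s"]) simp
    qed (use True in auto)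
    have "ennreal (g z) * indicator (ball 0 z) x + (\<integral>\<^sup>+s. ?K x s \<partial>lborel) \<le> ennreal (g z) + ennreal (g (norm x) - g z)"
      using True le by (intro add_mono) auto
    also have "\<dots> = ennreal (g (norm x))"
      using gz mono by (simp flip: ennreal_plus)
    finally show ?thesis using True by simp
  next
    case False
    have "(\<integral>\<^sup>+s. ?K x s \<partial>lborel) = (\<integral>\<^sup>+s. 0 \<partial>(lborel :: real measure))"
      by (rule nn_integral_cong) (use False in \<open>auto simp: indicator_def\<close>)
    then show ?thesis using False by simp
  qed
  \<comment> \<open>The antiderivative of \<open>k s * s ^ d\<close> that vanishes at 0. Integration
    by parts gives \<open>- g s * s ^ d\<close> plus \<open>d\<close> times the integral of g(r)
    r^(d-1); the exponential part of the latter becomes an incomplete Gamma function after the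
    substitution t = 2 h r, whence the power of \<open>2 * h\<close>.\<close>
  define P where "P s = - g s * s ^ d + z * s ^ d - real d * s ^ Suc d / real (Suc d) +
      real d / (2 * h) ^ Suc d * (Gamma (real (Suc d)) - incomplete_Gamma (Suc d) (2 * h * s))" for s
  have dP: "(P has_real_derivative k s * s ^ d) (at s)" for s
  proof -
    have inc: "((\<lambda>s. incomplete_Gamma (Suc d) (2 * h * s)) has_real_derivative - ((2 * h * s) ^ d * exp (- (2 * h * s))) * (2 * h)) (at s)"
      by (rule DERIV_chain2[OF DERIV_incomplete_Gamma]) (auto intro!: derivative_eq_intros)
    have "(P has_real_derivative
       (k s * s ^ d - g s * (real d * s ^ (d - 1))) + z * (real d * s ^ (d - 1)) - real d * (real (Suc d) * s ^ d) / real (Suc d) +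
       real d / (2 * h) ^ Suc d * (0 - - ((2 * h * s) ^ d * exp (- (2 * h * s))) * (2 * h))) (at s)"
      unfolding P_def
      by (rule DERIV_add DERIV_diff DERIV_cmult DERIV_const inc DERIV_cdivide derivative_eq_intros dg refl | simp)+
    moreover have "real d / (2 * h) ^ Suc d * (0 - - ((2 * h * s) ^ d * exp (- (2 * h * s))) * (2 * h)) = real d * s ^ d * exp (- (2 * h * s))"
      using h by (simp add: power_mult_distrib field_simps)
    moreover have "real d * (real (Suc d) * s ^ d) / real (Suc d) = real d * s ^ d" by simp
    moreover have "g s * (real d * s ^ (d - 1)) = z * (real d * s ^ (d - 1)) - real d * s ^ d + real d * s ^ d * exp (- (2 * h * s))"
    proof -
      have "g s * (real d * t) = z * (real d * t) - real d * (s * t) + real d * (s * t) * exp (- (2 * h * s))" for t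
        by (simp add: g_def algebra_simps)
      moreover have "s * s ^ (d - 1) = s ^ d" using d by (metis power_eq_if neq0_conv)
      ultimately show ?thesis by metis
    qed
    ultimately show ?thesis by simp
  qed
  have P0: "P 0 = 0" using d by (simp add: P_def incomplete_Gamma_0)
  have Kswap: "(\<integral>\<^sup>+x. (\<integral>\<^sup>+s. ?K x s \<partial>lborel) \<partial>lborel) = ennreal (V * P z)"
  proof -
    have "(\<integral>\<^sup>+x. (\<integral>\<^sup>+s. ?K x s \<partial>lborel) \<partial>lborel) = (\<integral>\<^sup>+s. (\<integral>\<^sup>+x. ?K x s \<partial>lborel) \<partial>lborel)"
      by (rule lborel_pair.Fubini'[symmetric]) measurable
    also have "\<dots> = (\<integral>\<^sup>+s. ennreal V * (ennreal (k s * s ^ d) * indicator {0..z} s) \<partial>lborel)"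
    \<comment> \<open>The half-open and the closed interval differ only at
      \<open>s = z\<close>.\<close>
    proof (rule nn_integral_cong_AE)
      have "AE s in lborel. s \<noteq> z" by (rule AE_lborel_singleton)
      then show "AE s in lborel. (\<integral>\<^sup>+x. ?K x s \<partial>lborel) = ennreal V * (ennreal (k s * s ^ d) * indicator {0..z} s)"
      proof eventually_elim
        fix s assume s: "s \<noteq> z"
        show "(\<integral>\<^sup>+x. ?K x s \<partial>lborel) = ennreal V * (ennreal (k s * s ^ d) * indicator {0..z} s)"
        proof (cases "s \<in> {0..<z}")
          case True
          have "(\<integral>\<^sup>+x. ?K x s \<partial>lborel) = (\<integral>\<^sup>+x. ennreal (k s) * indicator (cball 0 s) x \<partial>(lborel :: 'a measure))"
            using True by (intro nn_integral_cong) (auto simp: indicator_def)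
          also have "\<dots> = ennreal (k s) * ennreal (V * s ^ d)"
            using True by (subst nn_integral_cmult_indicator) (simp_all add: emeasure_cball V_def d_def)
          finally show ?thesis
            using True V k0[of s] by (simp add: ennreal_mult[symmetric] mult_ac)
        qed (use s in \<open>auto simp: indicator_def\<close>)
      qed
    qed
    also have "\<dots> = ennreal V * (\<integral>\<^sup>+s. ennreal (k s * s ^ d) * indicator {0..z} s \<partial>lborel)"
      by (rule nn_integral_cmult) measurable
    also have "(\<integral>\<^sup>+s. ennreal (k s * s ^ d) * indicator {0..z} s \<partial>lborel) = ennreal (P z - P 0)"
    proof (rule nn_integral_FTC_Icc)
      show "(\<lambda>s. k s * s ^ d) \<in> borel_measurable borel" by measurable
    qed (use dP k0 z in auto)
    finally show ?thesis using V by (simp add: P0 ennreal_mult')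
  qed
  have Pz: "P z \<ge> 0"
  proof -
    have "P 0 \<le> P z"
      by (rule DERIV_nonneg_imp_nondecreasing[of 0 z P]) (use z dP k0 in \<open>auto intro!: exI\<close>)
    then show ?thesis by (simp add: P0)
  qed
  \<comment> \<open>The layer-cake boundary term, \<open>g z\<close> times the volume of the ball,
    cancels the first summand of \<open>P z\<close>.\<close>
  have "V * (z ^ Suc d / real (Suc d) + real d / (2 * h) ^ Suc d * (Gamma (real (Suc d)) - incomplete_Gamma (Suc d) (2 * h * z))) =
      g z * (V * z ^ d) + V * P z"
  proof -
    have "z ^ Suc d / real (Suc d) = z * z ^ d - real d * z ^ Suc d / real (Suc d)"
      by (simp add: field_simps)
    then have "P z = - g z * z ^ d + (z ^ Suc d / real (Suc d) +
        real d / (2 * h) ^ Suc d * (Gamma (real (Suc d)) - incomplete_Gamma (Suc d) (2 * h * z)))"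
      unfolding P_def by linarith
    then show ?thesis by (simp only: distrib_left mult_minus_left mult_minus_right mult.left_commute[of V])
  qed
  then have "ennreal (V * (z ^ Suc d / real (Suc d) + real d / (2 * h) ^ Suc d * (Gamma (real (Suc d)) - incomplete_Gamma (Suc d) (2 * h * z)))) =
      ennreal (g z) * ennreal (V * z ^ d) + ennreal (V * P z)"
    using gz V z Pz by (simp add: ennreal_mult ennreal_plus)
  also have "\<dots> = (\<integral>\<^sup>+x. ennreal (g z) * indicator (ball 0 z) (x::'a) + (\<integral>\<^sup>+s. ?K x s \<partial>lborel) \<partial>lborel)"
  proof -
    have "(\<integral>\<^sup>+x. ennreal (g z) * indicator (ball 0 z) (x::'a) \<partial>lborel) = ennreal (g z) * ennreal (V * z ^ d)"
      using z by (subst nn_integral_cmult_indicator) (simp_all add: emeasure_ball V_def d_def)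
    moreover have "(\<lambda>x::'a. ennreal (g z) * indicator (ball 0 z) x) \<in> borel_measurable lborel"
      by (intro borel_measurable_times_ennreal borel_measurable_const borel_measurable_indicator) simp
    ultimately show ?thesis unfolding Kswap[symmetric] by (subst nn_integral_add) auto
  qed
  also have "\<dots> \<le> (\<integral>\<^sup>+x. (if norm x < z then ennreal (g (norm x)) else 0) \<partial>(lborel :: 'a measure))"
    by (intro nn_integral_mono point)
  finally show ?thesis unfolding V_def .
qed

text \<open>The constant in phase-space form: this times z^(d+1) is (2 pi)^(-d) times the integral
  of z - |\<xi>| over the ball of radius z. The factor (2 pi)^d splits into a power of 4 pi and the
  power of pi that belongs to the unit ball volume.\<close>

lemma C_const_1_eq:
  assumes "d > 0"
  shows "C_const (Suc d) 1 = unit_ball_vol (real d) / ((2 * pi) ^ d * real (Suc d))"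
proof -
  have "(2 * pi) ^ d = (2 * pi) powr real d" by (simp add: powr_realpow)
  also have "\<dots> = ((2 * pi) powr 2) powr (real d / 2)" by (simp only: powr_powr) simp
  also have "(2 * pi) powr 2 = (4 * pi) * pi" by (simp add: power2_eq_square)
  also have "\<dots> powr (real d / 2) = (4 * pi) powr (real d / 2) * pi powr (real d / 2)"
    by (rule powr_mult)
  finally have pow: "(2 * pi) ^ d = (4 * pi) powr (real d / 2) * pi powr (real d / 2)" .
  have "Gamma (real (Suc d) + 1) = real (Suc d) * Gamma (real (Suc d))"
    using Gamma_fact[of "Suc d", where 'a = real] Gamma_fact[of d, where 'a = real] by (simp add: add_ac)
  moreover have "Gamma (1 + 1 :: real) = 1" using Gamma_fact[of 1, where 'a = real] by simp
  moreover have half: "(real (Suc d) + 1) / 2 = real d / 2 + 1" "(real (Suc d) - 1) / 2 = real d / 2" by simp_all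
  moreover have "Gamma (real (Suc d)) \<noteq> 0" "Gamma (real d / 2 + 1) \<noteq> 0"
    by (simp_all add: Gamma_real_pos less_imp_neq[symmetric] add_nonneg_pos del: of_nat_Suc)
  ultimately have "C_const (Suc d) 1 = 1 / ((4 * pi) powr (real d / 2) * Gamma (real d / 2 + 1) * real (Suc d))"
    unfolding C_const_def half by (simp del: of_nat_Suc)
  then show ?thesis
    unfolding unit_ball_vol_def pow by (simp del: of_nat_Suc)
qed

section \<open>Growing cubes and assembly of the constants\<close>

theorem theorem1p3:
  fixes \<Omega> B :: "('a::euclidean_space \<times> real) set" and F :: "'a set" and n :: nat and z :: real
  assumes dim: "n = DIM('a \<times> real)"
    and admissible: "admissible_domain \<Omega> F B"
    and John: "\<Omega> \<subseteq> F \<times> {..<0}"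
    and z: "z > 0"
  shows "riesz_mean_1 \<Omega> F z \<ge>
    ennreal (C_const n 1 * measure lborel F * z ^ n +
      (real n - 1) * unit_ball_vol (real n - 1) / (2 * pi) ^ (n - 1) *
        (measure lborel F / (2 * depth \<Omega>) ^ n) *
        (Gamma (real n) - incomplete_Gamma n (2 * depth \<Omega> * z)))"
proof -
  define d where "d = DIM('a)"
  have n: "n = Suc d" and d: "d > 0" by (simp_all add: dim d_def)
  have \<Omega>: "open \<Omega>" "bounded \<Omega>" and fr: "frontier \<Omega> = F \<times> {0} \<union> B" and B: "B \<subseteq> {x. snd x < 0}"
    and mF: "measure lborel F > 0"
    using admissible unfolding admissible_domain_def by auto
  have ne: "\<Omega> \<noteq> {}"
  proof
    assume "\<Omega> = {}"
    then have "F = {}" using fr by auto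
    then show False using mF by simp
  qed
  \<comment> \<open>\<open>B\<close> lies strictly below the surface, so \<open>F\<close> is the
    full zero section of the closed frontier and inherits closedness, hence measurability.\<close>
  have "F = (\<lambda>y. (y, 0)) -` frontier \<Omega>"
    using fr B by auto
  then have "closed F"
    by (simp add: closed_vimage continuous_on_Pair)
  then have F: "F \<in> sets borel" by simp
  have "F \<subseteq> fst ` frontier \<Omega>" using fr by force
  moreover have "bounded (frontier \<Omega>)" by (rule compact_imp_bounded[OF compact_frontier_bounded[OF \<Omega>(2)]])
  ultimately have Fb: "bounded F" by (meson bounded_fst bounded_subset)
  define h where "h = depth \<Omega>"
  have hle: "\<bar>snd x\<bar> \<le> h" if "x \<in> \<Omega>" for x
    unfolding h_def depth_def
  proof (rule cSUP_upper[OF that])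
    obtain M where "\<And>x. x \<in> \<Omega> \<Longrightarrow> norm x \<le> M" using \<Omega>(2) unfolding bounded_iff by blast
    then show "bdd_above ((\<lambda>x. \<bar>snd x\<bar>) ` \<Omega>)"
      by (intro bdd_aboveI2[where M = M]) (metis norm_snd_le order_trans prod.collapse real_norm_def)
  qed
  have h: "h > 0"
  proof -
    obtain x where x: "x \<in> \<Omega>" using ne by blast
    then have "snd x < 0" using John by auto
    then show ?thesis using hle[OF x] by linarith
  qed
  obtain M where M: "\<And>y. y \<in> F \<Longrightarrow> norm y \<le> M" using Fb unfolding bounded_iff by blast
  \<comment> \<open>The constant part makes every cube contain \<open>F\<close>; the summand
    \<open>real N\<close> sends the side to infinity.\<close>
  define L where "L N = 2 * \<bar>M\<bar> + 1 + real N" for N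
  define \<delta> where "\<delta> N = 2 * pi / L N" for N
  have L: "L N > 0" for N by (simp add: L_def add_nonneg_pos add_pos_nonneg)
  have FL: "F \<subseteq> centered_cube (L N)" for N
  proof
    fix y assume "y \<in> F"
    have "y \<bullet> b \<in> {- (L N / 2)..L N / 2}" if "b \<in> Basis" for b
    proof -
      have "\<bar>y \<bullet> b\<bar> \<le> \<bar>M\<bar>" using Basis_le_norm[OF that, of y] M[OF \<open>y \<in> F\<close>] by linarith
      moreover have "\<bar>M\<bar> \<le> L N / 2" by (simp add: L_def)
      ultimately have "\<bar>y \<bullet> b\<bar> \<le> L N / 2" by (rule order_trans)
      then show ?thesis unfolding atLeastAtMost_iff abs_le_iff by linarith
    qed
    then show "y \<in> centered_cube (L N)" unfolding mem_centered_cube by blast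
  qed
  have \<delta>: "\<delta> N > 0" for N using L[of N] by (simp add: \<delta>_def)
  have \<delta>0: "\<delta> \<longlonglongrightarrow> 0"
  proof -
    have "filterlim L at_top sequentially"
      unfolding L_def by (rule filterlim_tendsto_add_at_top[OF tendsto_const filterlim_real_sequentially])
    then show ?thesis
      unfolding \<delta>_def by (intro tendsto_divide_0[OF tendsto_const] filterlim_at_top_imp_at_infinity)
  qed
  define g where "g r = z - r + r * exp (- (2 * r * h))" for r
  \<comment> \<open>With \<open>\<delta> N = 2 * pi / L N\<close>, the prefactor of the lattice
    bound is \<open>c * \<delta> N ^ d\<close>. Dividing by the fixed \<open>c\<close> leaves a pure
    Riemann sum.\<close>
  define c where "c = measure lborel F / (2 * pi) ^ d"
  have c: "c > 0" using mF by (simp add: c_def)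
  let ?R = "riesz_mean_1 \<Omega> F z"
  let ?S = "\<lambda>N. {\<xi>. \<xi> \<in> scaled_lattice (\<delta> N) \<and> norm (\<xi>::'a) < z}"
  have bound: "ennreal (\<delta> N ^ d * (\<Sum>\<xi>\<in>?S N. g (norm \<xi>))) \<le> ?R / ennreal c" for N
  proof -
    have "uminus ` ?S N = ?S N"
    proof
      show sub: "uminus ` ?S N \<subseteq> ?S N" by (auto simp: scaled_lattice_minus)
      have "uminus ` uminus ` ?S N \<subseteq> uminus ` ?S N" using sub by (rule image_mono)
      then show "?S N \<subseteq> uminus ` ?S N" by (simp add: image_image)
    qed
    then have "ennreal (measure lborel F / L N ^ DIM('a) * (\<Sum>\<xi>\<in>?S N. z - norm \<xi> + norm \<xi> * exp (- (2 * norm \<xi> * h)))) \<le> ?R"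
      by (intro riesz_mean_ge_lattice[OF \<Omega> ne John F Fb _ hle L FL] finite_scaled_lattice_ball \<delta>)
        (use h in \<open>auto simp: \<delta>_def\<close>)
    moreover have "measure lborel F / L N ^ DIM('a) = c * \<delta> N ^ d"
      using L[of N] by (simp add: c_def \<delta>_def d_def power_divide)
    ultimately have "ennreal (c * (\<delta> N ^ d * (\<Sum>\<xi>\<in>?S N. g (norm \<xi>)))) \<le> ?R"
      by (simp add: g_def mult.assoc)
    then have "ennreal (\<delta> N ^ d * (\<Sum>\<xi>\<in>?S N. g (norm \<xi>))) * ennreal c \<le> ?R"
      using c by (simp add: ennreal_mult' mult.commute)
    from divide_right_mono_ennreal[OF this, of "ennreal c"] show ?thesis
      using c by (simp add: mult_divide_eq_ennreal)
  qed
  define X where "X = unit_ball_vol (real d) * (z ^ Suc d / real (Suc d) +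
      real d / (2 * h) ^ Suc d * (Gamma (real (Suc d)) - incomplete_Gamma (Suc d) (2 * h * z)))"
  have "ennreal X \<le> (\<integral>\<^sup>+x. (if norm x < z then ennreal (g (norm x)) else 0) \<partial>(lborel :: 'a measure))"
    unfolding X_def g_def d_def by (rule radial_integral_ge[OF h z])
  also have "\<dots> \<le> liminf (\<lambda>N. ennreal (\<delta> N ^ DIM('a) * (\<Sum>\<xi>\<in>?S N. g (norm \<xi>))))"
  proof (rule lattice_riemann_sum_liminf[OF _ _ \<delta> \<delta>0])
    show "continuous_on UNIV g" unfolding g_def by (intro continuous_intros)
    show "0 \<le> g r" if "0 \<le> r" "r < z" for r using that by (simp add: g_def)
  qed
  also have "\<dots> \<le> ?R / ennreal c"
    using bound by (intro Liminf_le always_eventually) (simp_all add: d_def)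
  finally have "ennreal X * ennreal c \<le> ?R / ennreal c * ennreal c"
    by (rule mult_right_mono) simp
  also have "\<dots> = ?R"
    using c by (simp add: ennreal_divide_times)
  finally have "ennreal (X * c) \<le> ?R"
    using c by (simp add: ennreal_mult'')
  moreover have "X * c = C_const n 1 * measure lborel F * z ^ n +
      (real n - 1) * unit_ball_vol (real n - 1) / (2 * pi) ^ (n - 1) *
        (measure lborel F / (2 * depth \<Omega>) ^ n) *
        (Gamma (real n) - incomplete_Gamma n (2 * depth \<Omega> * z))"
  proof -
    have Suc_minus: "real (Suc d) - 1 = real d" "Suc d - 1 = d" by simp_all
    then show ?thesis
      unfolding n C_const_1_eq[OF d] X_def c_def h_def[symmetric] Suc_minus
      by (simp add: distrib_left distrib_right mult_ac del: of_nat_Suc power_Suc)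
  qed
  ultimately show ?thesis by simp
qed

end
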